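(* The ladder shifts and the differential equations are compatible as vector differential–difference systems: there exist sequences of $(d_2+1)\times(d_2+1)$ fundamental (invertible) matrix solutions $\{\mathbf\Psi_N(x)\}_{N\ge d_2+1}$ and of $(d_1+1)\times(d_1+1)$ fundamental matrix solutions $\{\mathbf\Phi_N(y)\}_{N\ge d_1+1}$ satisfying simultaneously $$\mathbf\Psi_{N+1}(x)=\mathbf a_N(x)\mathbf\Psi_N(x),\qquad \partial_x\mathbf\Psi_N(x)=-D_1^N(x)\mathbf\Psi_N(x),\qquad N\ge d_2+1,$$ and $$\mathbf\Phi_{N+1}(y)=\mathbf b_N(y)\mathbf\Phi_N(y),\qquad \partial_y\mathbf\Phi_N(y)=-D_2^N(y)\mathbf\Phi_N(y),\qquad N\ge d_1+1,$$ respectively. The same result holds for the barred quantities and the shifts $N\mapsto N-1$: there exist sequences of $(d_1+1)\times(d_1+1)$ fundamental matrix solutions $\underline{\mathbf\Psi}^{N-1}(y)$ and of $(d_2+1)\times(d_2+1)$ fundamental matrix solutions $\underline{\mathbf\Phi}^{N-1}(x)$ satisfying simultaneously $$\underline{\mathbf\Psi}^{N-1}(y)=\underline{\mathbf\Psi}^N(y)\,\underline{\mathbf b}^N(y),\qquad \partial_y\underline{\mathbf\Psi}^{N-1}(y)=\underline{\mathbf\Psi}^{N-1}(y)\,\underline D_2^N(y),\qquad N\ge d_1+1,$$ and $$\underline{\mathbf\Phi}^{N-1}(x)=\underline{\mathbf\Phi}^N(x)\,\underline{\mathbf a}^N(x),\qquad \partial_x\underline{\mathbf\Phi}^{N-1}(x)=\underline{\mathbf\Phi}^{N-1}(x)\,\underline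 D_1^N(x),\qquad N\ge d_2+1,$$ respectively.
   Context: **Setting.** Fix integers $d_1,d_2\ge1$ and $V_1(x)=\sum_{K=1}^{d_1+1}\frac{u_K}{K}x^K$, $V_2(y)=\sum_{J=1}^{d_2+1}\frac{v_J}{J}y^J$ with $u_{d_1+1}\ne0$, $v_{d_2+1}\ne0$, and contours $\Gamma_x,\Gamma_y$ such that all integrals below converge and integrations by parts produce no boundary terms. Assume there are monic polynomials $\pi_n,\sigma_n$ of degree $n$ ($n\ge0$) with $\int_{\Gamma_x}\int_{\Gamma_y}\pi_n(x)\sigma_m(y)e^{-V_1(x)-V_2(y)+xy}\,dy\,dx=h_n\delta_{nm}$, $h_n\neq0$. Fix $\sqrt{h_n}$ and put $\psi_n(x)=\pi_n(x)e^{-V_1(x)}/\sqrt{h_n}$, $\phi_n(y)=\sigma_n(y)e^{-V_2(y)}/\sqrt{h_n}$. **Recursion coefficients.** There are unique numbers $\alpha_j(n)$ ($-1\le j\le d_2$), $\beta_j(n)$ ($-1\le j\le d_1$), with $\alpha_{-1}(n)=\beta_{-1}(n)=\gamma(n)=\sqrt{h_{n+1}}/\sqrt{h_n}$ and $\alpha_j(n)=\beta_j(n)=0$ for $n<j$, such that (terms with negative index omitted) $x\psi_n=\sum_{j=-1}^{d_2}\alpha_j(n)\psi_{n-j}$, $\partial_x\psi_n=-\sum_{j=-1}^{d_1}\beta_j(n+j)\psi_{n+j}$, $y\phi_n=\sum_{j=-1}^{d_1}\beta_j(n)\phi_{n-j}$, $\partial_y\phi_n=-\sum_{j=-1}^{d_2}\alpha_j(n+j)\phi_{n+j}$.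 Moreover $\alpha_{d_2}(n)\ne0$ ($n\ge d_2$) and $\beta_{d_1}(n)\neq0$ ($n\ge d_1$). **Ladder matrices.** $\mathbf a_N(x)$ ($N\ge d_2$) is the $(d_2+1)\times(d_2+1)$ matrix with $1$'s on the first superdiagonal, last row $\frac1{\gamma(N)}(-\alpha_{d_2}(N),\dots,-\alpha_1(N),x-\alpha_0(N))$, other entries $0$; $\mathbf b_N(y)$ ($N\ge d_1$) is the $(d_1+1)\times(d_1+1)$ matrix with $1$'s on the first superdiagonal, last row $\frac1{\gamma(N)}(-\beta_{d_1}(N),\dots,-\beta_1(N),y-\beta_0(N))$, other entries $0$. Write $\mathbf a^N=\mathbf a_N^{-1}$, $\mathbf b^N=\mathbf b_N^{-1}$. $\underline{\mathbf a}^N(x)$ is the $(d_2+1)\times(d_2+1)$ matrix with $1$'s on the first superdiagonal, first column $\frac1{\gamma(N-1)}(x-\alpha_0(N),-\alpha_1(N+1),\dots,-\alpha_{d_2}(N+d_2))^t$, other entries $0$; $\underline{\mathbf b}^N(y)$ is the $(d_1+1)\times(d_1+1)$ matrix with $1$'s on the first superdiagonal, first column $\frac1{\gamma(N-1)}(y-\beta_0(N),-\beta_1(N+1),\dots,-\beta_{d_1}(N+d_1))^t$, other entries $0$. Write $\underline{\mathbf a}_N=(\underline{\mathbf a}^N)^{-1}$, $\underline{\mathbf b}_N=(\underline{\mathbf b}^N)^{-1}$. **Differential matrices.** For $j\ge-1$ put $\beta^N_j=\mathrm{diag}(\beta_j(N+j-d_2),\dots,\beta_j(N+j))$, $\alpha^N_j=\mathrm{diag}(\alpha_j(N+j-d_1),\dots,\alpha_j(N+j))$,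 $\underline\alpha^N_j=\mathrm{diag}(\alpha_j(N),\dots,\alpha_j(N+d_1))$, $\underline\beta^N_j=\mathrm{diag}(\beta_j(N),\dots,\beta_j(N+d_2))$. Then $D_1^N(x)=\beta^N_{-1}\mathbf a^{N-1}+\beta_0^N+\sum_{j=1}^{d_1}\beta_j^N\mathbf a_{N+j-1}\cdots\mathbf a_N$, $D_2^N(y)=\alpha^N_{-1}\mathbf b^{N-1}+\alpha_0^N+\sum_{j=1}^{d_2}\alpha_j^N\mathbf b_{N+j-1}\cdots\mathbf b_N$, $\underline D_2^N(y)=\underline{\mathbf b}_N\underline\alpha_{-1}^{N-1}+\underline\alpha_0^{N-1}+\sum_{j=1}^{d_2}\underline{\mathbf b}^{N-1}\cdots\underline{\mathbf b}^{N-j}\underline\alpha_j^{N-1}$, $\underline D_1^N(x)=\underline{\mathbf a}_N\underline\beta_{-1}^{N-1}+\underline\beta_0^{N-1}+\sum_{j=1}^{d_1}\underline{\mathbf a}^{N-1}\cdots\underline{\mathbf a}^{N-j}\underline\beta_j^{N-1}$.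
   Formalization: The two barred differential equations are asserted only for N ≥ max(d_1,d_2)+1, since for smaller N the barred D_2^N (resp. D_1^N) involves γ at negative indices and the system is incompatible; barred shifts and invertibility keep the printed ranges. *)

theory Defs
  imports "HOL-Complex_Analysis.Complex_Analysis"
    "Jordan_Normal_Form.Gauss_Jordan_Elimination"
begin

text \<open>
  A contour is parametrised by the whole real line, and contour integrals are Henstock-Kurzweil
  integrals, so conditionally convergent (improper) integrals are allowed.
\<close>

definition is_contour :: "(real \<Rightarrow> complex) \<Rightarrow> bool" where
  "is_contour G \<longleftrightarrow> (\<forall>a b. G piecewise_C1_differentiable_on {a..b})"

definition integrable_along :: "(real \<Rightarrow> complex) \<Rightarrow> (complex \<Rightarrow> complex) \<Rightarrow> bool" where
  "integrable_along G f \<longleftrightarrow> (\<lambda>t. f (G t) * vector_derivative G (at t)) integrable_on UNIV"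

definition integral_along :: "(real \<Rightarrow> complex) \<Rightarrow> (complex \<Rightarrow> complex) \<Rightarrow> complex" where
  "integral_along G f = integral UNIV (\<lambda>t. f (G t) * vector_derivative G (at t))"

definition potential :: "nat \<Rightarrow> (nat \<Rightarrow> complex) \<Rightarrow> complex \<Rightarrow> complex" where
  "potential d u x = (\<Sum>K = 1..d+1. u K / of_nat K * x ^ K)"

definition integrand ::
  "(complex \<Rightarrow> complex) \<Rightarrow> (complex \<Rightarrow> complex) \<Rightarrow> complex poly \<Rightarrow> complex poly \<Rightarrow> complex \<Rightarrow> complex \<Rightarrow> complex"
where
  "integrand V1 V2 p q x y = poly p x * poly q y * exp (- V1 x - V2 y + x * y)"

definition double_integral ::
  "(real \<Rightarrow> complex) \<Rightarrow> (real \<Rightarrow> complex) \<Rightarrow> (complex \<Rightarrow> complex \<Rightarrow> complex) \<Rightarrow> complex"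
where
  "double_integral Gx Gy F = integral_along Gx (\<lambda>x. integral_along Gy (\<lambda>y. F x y))"

text \<open>
  Convergence of all integrals of polynomials against the weight, and vanishing of the boundary
  terms: the integral of every total derivative in \<open>x\<close> or in \<open>y\<close> is zero.
\<close>

definition admissible_contours ::
  "(complex \<Rightarrow> complex) \<Rightarrow> (complex \<Rightarrow> complex) \<Rightarrow> (real \<Rightarrow> complex) \<Rightarrow> (real \<Rightarrow> complex) \<Rightarrow> bool"
where
  "admissible_contours V1 V2 Gx Gy \<longleftrightarrow>
     is_contour Gx \<and> is_contour Gy \<and>
     (\<forall>p q. (\<forall>x\<in>range Gx. integrable_along Gy (integrand V1 V2 p q x)) \<and>
            integrable_along Gx (\<lambda>x. integral_along Gy (integrand V1 V2 p q x))) \<and>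
     (\<forall>p q. double_integral Gx Gy (\<lambda>x y. deriv (\<lambda>\<xi>. integrand V1 V2 p q \<xi> y) x) = 0 \<and>
            double_integral Gx Gy (\<lambda>x y. deriv (\<lambda>\<eta>. integrand V1 V2 p q x \<eta>) y) = 0)"

definition biorthogonal_polys ::
  "(complex \<Rightarrow> complex) \<Rightarrow> (complex \<Rightarrow> complex) \<Rightarrow> (real \<Rightarrow> complex) \<Rightarrow> (real \<Rightarrow> complex) \<Rightarrow>
   (nat \<Rightarrow> complex poly) \<Rightarrow> (nat \<Rightarrow> complex poly) \<Rightarrow> (nat \<Rightarrow> complex) \<Rightarrow> bool"
where
  "biorthogonal_polys V1 V2 Gx Gy \<pi> \<sigma> h \<longleftrightarrow>
     (\<forall>n. degree (\<pi> n) = n \<and> lead_coeff (\<pi> n) = 1 \<and>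
          degree (\<sigma> n) = n \<and> lead_coeff (\<sigma> n) = 1 \<and> h n \<noteq> 0) \<and>
     (\<forall>n m. double_integral Gx Gy (integrand V1 V2 (\<pi> n) (\<sigma> m)) = (if n = m then h n else 0))"

text \<open>\<open>r n\<close> is the chosen square root of \<open>h n\<close>.\<close>

definition quasi_poly ::
  "(complex \<Rightarrow> complex) \<Rightarrow> (nat \<Rightarrow> complex poly) \<Rightarrow> (nat \<Rightarrow> complex) \<Rightarrow> nat \<Rightarrow> complex \<Rightarrow> complex"
where
  "quasi_poly V p r n x = poly (p n) x * exp (- V x) / r n"

text \<open>
  \<open>\<alpha> j n\<close> stands for $\alpha_j(n)$; both indices are integers because \<open>j = - 1\<close> occurs, and only
  values with \<open>n \<ge> 0\<close> are constrained.  The index sets omit the terms \<open>\<psi>\<^sub>k\<close>, \<open>\<phi>\<^sub>k\<close> with \<open>k < 0\<close>.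
\<close>

definition recursion_coefficients ::
  "nat \<Rightarrow> nat \<Rightarrow> (nat \<Rightarrow> complex) \<Rightarrow> (nat \<Rightarrow> complex \<Rightarrow> complex) \<Rightarrow> (nat \<Rightarrow> complex \<Rightarrow> complex) \<Rightarrow>
   (int \<Rightarrow> int \<Rightarrow> complex) \<Rightarrow> (int \<Rightarrow> int \<Rightarrow> complex) \<Rightarrow> bool"
where
  "recursion_coefficients d1 d2 r \<psi> \<phi> \<alpha> \<beta> \<longleftrightarrow>
     (\<forall>n. \<alpha> (- 1) (int n) = r (n + 1) / r n \<and> \<beta> (- 1) (int n) = r (n + 1) / r n) \<and>
     (\<forall>n. \<forall>j\<in>{- 1..int d2}. int n < j \<longrightarrow> \<alpha> j (int n) = 0) \<and>
     (\<forall>n. \<forall>j\<in>{- 1..int d1}. int n < j \<longrightarrow> \<beta> j (int n) = 0) \<and>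
     (\<forall>n x. x * \<psi> n x =
        (\<Sum>j\<in>{j\<in>{- 1..int d2}. 0 \<le> int n - j}. \<alpha> j (int n) * \<psi> (nat (int n - j)) x)) \<and>
     (\<forall>n x. deriv (\<psi> n) x =
        - (\<Sum>j\<in>{j\<in>{- 1..int d1}. 0 \<le> int n + j}. \<beta> j (int n + j) * \<psi> (nat (int n + j)) x)) \<and>
     (\<forall>n y. y * \<phi> n y =
        (\<Sum>j\<in>{j\<in>{- 1..int d1}. 0 \<le> int n - j}. \<beta> j (int n) * \<phi> (nat (int n - j)) y)) \<and>
     (\<forall>n y. deriv (\<phi> n) y =
        - (\<Sum>j\<in>{j\<in>{- 1..int d2}. 0 \<le> int n + j}. \<alpha> j (int n + j) * \<phi> (nat (int n + j)) y))"

text \<open>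
  The constructions come in pairs exchanged by $(d_2,\alpha) \leftrightarrow (d_1,\beta)$, so each is
  defined once, for a size parameter \<open>d\<close> and coefficients \<open>c\<close>, with \<open>c (- 1) N\<close> in the role of
  $\gamma(N)$:
  \<^item> \<open>ladder d2 \<alpha> N x\<close> is $\mathbf a_N(x)$ and \<open>ladder d1 \<beta> N y\<close> is $\mathbf b_N(y)$;
  \<^item> \<open>ladder_bar d2 \<alpha> N x\<close> is $\underline{\mathbf a}^N(x)$ and \<open>ladder_bar d1 \<beta> N y\<close> is
    $\underline{\mathbf b}^N(y)$;
  \<^item> \<open>diff_matrix d2 \<alpha> d1 \<beta> N x\<close> is $D_1^N(x)$ and \<open>diff_matrix d1 \<beta> d2 \<alpha> N y\<close> is $D_2^N(y)$;
  \<^item> \<open>diff_matrix_bar d2 \<alpha> d1 \<beta> N x\<close> is $\underline D_1^N(x)$ and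
    \<open>diff_matrix_bar d1 \<beta> d2 \<alpha> N y\<close> is $\underline D_2^N(y)$.
\<close>

definition ladder :: "nat \<Rightarrow> (int \<Rightarrow> int \<Rightarrow> complex) \<Rightarrow> int \<Rightarrow> complex \<Rightarrow> complex mat" where
  "ladder d c N z = Matrix.mat (d+1) (d+1) (\<lambda>(i, k).
     if i < d then (if k = i + 1 then 1 else 0)
     else (if k = d then z - c 0 N else - c (int (d - k)) N) / c (- 1) N)"

definition ladder_bar :: "nat \<Rightarrow> (int \<Rightarrow> int \<Rightarrow> complex) \<Rightarrow> int \<Rightarrow> complex \<Rightarrow> complex mat" where
  "ladder_bar d c N z = Matrix.mat (d+1) (d+1) (\<lambda>(i, k).
     if k = 0 then (if i = 0 then z - c 0 N else - c (int i) (N + int i)) / c (- 1) (N - 1)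
     else (if k = i + 1 then 1 else 0))"

definition mat_inv :: "complex mat \<Rightarrow> complex mat" where
  "mat_inv A = the (mat_inverse A)"

definition diag_from :: "nat \<Rightarrow> (int \<Rightarrow> complex) \<Rightarrow> int \<Rightarrow> complex mat" where
  "diag_from d f M = Matrix.mat (d+1) (d+1) (\<lambda>(i, k). if i = k then f (M + int i) else 0)"

definition mat_sum :: "nat \<Rightarrow> (nat \<Rightarrow> complex mat) \<Rightarrow> nat set \<Rightarrow> complex mat" where
  "mat_sum n F J = Matrix.mat n n (\<lambda>(i, k). \<Sum>j\<in>J. F j $$ (i, k))"

text \<open>\<open>prod_up n A N j\<close> is $A_{N+j-1} \cdots A_N$, and \<open>prod_down n A N j\<close> is
  $A_{N-1} \cdots A_{N-j}$.\<close>

primrec prod_up :: "nat \<Rightarrow> (int \<Rightarrow> complex mat) \<Rightarrow> int \<Rightarrow> nat \<Rightarrow> complex mat" where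
  "prod_up n A N 0 = 1\<^sub>m n"
| "prod_up n A N (Suc j) = A (N + int j) * prod_up n A N j"

primrec prod_down :: "nat \<Rightarrow> (int \<Rightarrow> complex mat) \<Rightarrow> int \<Rightarrow> nat \<Rightarrow> complex mat" where
  "prod_down n A N 0 = 1\<^sub>m n"
| "prod_down n A N (Suc j) = prod_down n A N j * A (N - 1 - int j)"

definition diff_matrix ::
  "nat \<Rightarrow> (int \<Rightarrow> int \<Rightarrow> complex) \<Rightarrow> nat \<Rightarrow> (int \<Rightarrow> int \<Rightarrow> complex) \<Rightarrow> int \<Rightarrow> complex \<Rightarrow> complex mat"
where
  "diff_matrix d c e b N z =
     diag_from d (b (- 1)) (N - 1 - int d) * mat_inv (ladder d c (N - 1) z)
     + diag_from d (b 0) (N - int d)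
     + mat_sum (d+1) (\<lambda>j. diag_from d (b (int j)) (N + int j - int d)
                          * prod_up (d+1) (\<lambda>M. ladder d c M z) N j) {1..e}"

definition diff_matrix_bar ::
  "nat \<Rightarrow> (int \<Rightarrow> int \<Rightarrow> complex) \<Rightarrow> nat \<Rightarrow> (int \<Rightarrow> int \<Rightarrow> complex) \<Rightarrow> int \<Rightarrow> complex \<Rightarrow> complex mat"
where
  "diff_matrix_bar d c e b N z =
     mat_inv (ladder_bar d c N z) * diag_from d (b (- 1)) (N - 1)
     + diag_from d (b 0) (N - 1)
     + mat_sum (d+1) (\<lambda>j. prod_down (d+1) (\<lambda>M. ladder_bar d c M z) N j
                          * diag_from d (b (int j)) (N - 1)) {1..e}"

text \<open>
  \<open>diff_matrix_bar d c e b N z\<close> involves \<open>ladder_bar d c (N - int j) z\<close> for \<open>0 \<le> j \<le> e\<close>, hence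
  $\gamma(N-1-e)$.  As $\gamma(n)$ exists only for $n \ge 0$, the formula has a meaning only for
  \<open>N \<ge> int e + 1\<close>; for smaller \<open>N\<close> the differential equation is incompatible
  with the shifts, because it uses the recursion relation at index \<open>0\<close>, where the term with
  negative index is missing.
\<close>

definition mat_has_derivative :: "(complex \<Rightarrow> complex mat) \<Rightarrow> complex mat \<Rightarrow> complex \<Rightarrow> bool" where
  "mat_has_derivative F F' z \<longleftrightarrow>
     (\<forall>i<dim_row F'. \<forall>k<dim_col F'.
        ((\<lambda>w. F w $$ (i, k)) has_field_derivative F' $$ (i, k)) (at z))"

definition everywhere_invertible :: "nat \<Rightarrow> (complex \<Rightarrow> complex mat) \<Rightarrow> bool" where
  "everywhere_invertible n F \<longleftrightarrow> (\<forall>z. F z \<in> carrier_mat n n \<and> invertible_mat (F z))"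

end

theory Submission
  imports Defs "Jordan_Normal_Form.Determinant"
begin

text \<open>
  A column of a matrix solution (a row, for the barred quantities) is a window of length \<open>d + 1\<close> of
  a scalar sequence \<open>f\<close> solving the recurrence that the ladder matrices encode, and the differential
  matrices encode \<open>f' = L f\<close> for a banded operator \<open>L\<close>.  Multiplication by \<open>x\<close> and differentiation act on
  the quasi-polynomials by band matrices \<open>A\<close> and \<open>- B\<^sup>T\<close>; since \<open>[\<partial>\<^sub>x, x] = 1\<close>, these satisfy
  \<open>B\<^sup>T A - A B\<^sup>T = 1\<close>.  This string equation makes \<open>f' = L f\<close> compatible with the recurrence, so it
  suffices to solve one linear differential system with entire coefficients for a single window
  and to extend by the recurrence.  The shifts without bar use \<open>A f = x f\<close>, \<open>L = - B\<^sup>T\<close>, those with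
  bar use the transposed pair \<open>A\<^sup>T g = x g\<close>, \<open>L = B\<close>.
\<close>

section \<open>Linear differential systems with entire coefficients\<close>

text \<open>The obstacle is the edge at index 0, where the recursion relations lose terms. Only the
  rows from \<open>d\<close> on and the columns from 1 on of \<open>A\<close> carry all
  \<open>d + 2\<close> entries, so only these equations are imposed on a solution. Compatibility at
  one index also needs the equations at the indices reached by a row of B^T or B, that is one index
  lower (rows) or \<open>e\<close> indices lower (columns). This is the origin of the bounds
  \<open>1 \<le> n\<close> and \<open>e \<le> n\<close>, which become N >= d + 1 and N >= e + 1.
  Moreover \<open>L\<close> reaches outside the window it differentiates, so a window must be
  extended in both directions. Hence both extreme coefficients of the recurrence have to be nonzero:
  one is gamma, the other is read off from leading coefficients in the derivative relation of the
  other family. Extension divides only by constants, so the finite system has entries entire in z,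
  and a power series at 0 solves it on the whole plane without monodromy.\<close>

fun ode_coeff :: "('a \<Rightarrow> 'a \<Rightarrow> complex fps) \<Rightarrow> 'a set \<Rightarrow> ('a \<Rightarrow> complex) \<Rightarrow> nat \<Rightarrow> 'a \<Rightarrow> complex" where
  "ode_coeff a I y 0 i = y i"
| "ode_coeff a I y (Suc n) i =
     (\<Sum>l\<in>I. \<Sum>j\<le>n. fps_nth (a i l) j * ode_coeff a I y (n - j) l) / of_nat (Suc n)"

text \<open>Majorant argument for the coefficients obtained by comparing powers in Y' = a Y. After
  weighting coefficient n with R^n, the recursion bounds it by R S / n times the bound on the
  earlier ones, where \<open>S\<close> dominates all weighted row sums of \<open>a\<close>. Once n
  exceeds R S this factor is at most 1, so a bound on finitely many coefficients persists.\<close>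

lemma ode_coeff_bounded:
  fixes R :: real
  assumes I: "finite I" and R: "R > 0" and i: "i \<in> I"
    and a: "\<And>i l. i \<in> I \<Longrightarrow> l \<in> I \<Longrightarrow> fps_conv_radius (a i l) = \<infinity>"
  shows "\<exists>C. \<forall>n. norm (ode_coeff a I y n i) * R ^ n \<le> C"
proof -
  let ?y = "ode_coeff a I y"
  define S where "S = (\<Sum>i\<in>I. \<Sum>l\<in>I. \<Sum>j. norm (fps_nth (a i l) j) * R ^ j)"
  have summ: "summable (\<lambda>j. norm (fps_nth (a i l) j) * R ^ j)" if "i \<in> I" "l \<in> I" for i l
  proof -
    have "summable (\<lambda>j. norm (fps_nth (a i l) j * of_real R ^ j))"
      by (rule abs_summable_in_conv_radius) (use a[OF that] in \<open>simp add: fps_conv_radius_def\<close>)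
    thus ?thesis using R by (simp add: norm_mult norm_power)
  qed
  have S: "(\<Sum>l\<in>I. \<Sum>j\<le>n. norm (fps_nth (a i l) j) * R ^ j) \<le> S" if i: "i \<in> I" for i n
  proof -
    have "(\<Sum>l\<in>I. \<Sum>j\<le>n. norm (fps_nth (a i l) j) * R ^ j)
        \<le> (\<Sum>l\<in>I. \<Sum>j. norm (fps_nth (a i l) j) * R ^ j)"
      by (intro sum_mono sum_le_suminf summ i) (use R in auto)
    also have "\<dots> \<le> S"
      unfolding S_def
      by (rule member_le_sum[OF i _ I]) (intro sum_nonneg suminf_nonneg summ, use R in auto)
    finally show ?thesis .
  qed
  \<comment> \<open>From index \<open>n0\<close> on the growth factor R S / n is at most 1;
    \<open>C\<close> crudely dominates everything up to \<open>n0\<close>.\<close>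
  obtain n0 :: nat where n0: "R * S \<le> real n0" using real_arch_simple by blast
  define C where "C = (\<Sum>n\<le>n0. \<Sum>i\<in>I. norm (?y n i) * R ^ n)"
  have C0: "C \<ge> 0" unfolding C_def by (intro sum_nonneg) (use R in auto)
  have "norm (?y n i) * R ^ n \<le> C" if "i \<in> I" for n i
    using that
  proof (induction n arbitrary: i rule: less_induct)
    case (less n)
    show ?case
    proof (cases "n \<le> n0")
      case True
      have "norm (?y n i) * R ^ n \<le> (\<Sum>i\<in>I. norm (?y n i) * R ^ n)"
        by (rule member_le_sum[OF less.prems _ I]) (use R in auto)
      also have "\<dots> \<le> C" unfolding C_def
        by (rule member_le_sum[where f = "\<lambda>n. \<Sum>i\<in>I. norm (?y n i) * R ^ n"])
          (use True R in \<open>auto intro!: sum_nonneg\<close>)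
      finally show ?thesis .
    next
      case False
      then obtain m where m: "n = Suc m" by (cases n) auto
      have "norm (?y n i) * R ^ n
          = norm (\<Sum>l\<in>I. \<Sum>j\<le>m. fps_nth (a i l) j * ?y (m - j) l) * R ^ n / real n"
        by (simp add: m norm_divide del: of_nat_Suc)
      also have "\<dots> \<le> (\<Sum>l\<in>I. \<Sum>j\<le>m. norm (fps_nth (a i l) j) * norm (?y (m - j) l)) * R ^ n / real n"
        by (intro divide_right_mono mult_right_mono sum_norm_le order.refl) (use R in \<open>auto simp: norm_mult\<close>)
      also have "\<dots> = R * (\<Sum>l\<in>I. \<Sum>j\<le>m. (norm (fps_nth (a i l) j) * R ^ j) * (norm (?y (m - j) l) * R ^ (m - j))) / real n"
        unfolding m power_Suc sum_distrib_left sum_distrib_right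
        by (intro arg_cong[where f = "\<lambda>x. x / _"] sum.cong refl)
          (simp add: power_diff field_simps R order.strict_implies_not_eq[OF R, symmetric])
      also have "\<dots> \<le> R * (\<Sum>l\<in>I. \<Sum>j\<le>m. (norm (fps_nth (a i l) j) * R ^ j) * C) / real n"
        by (intro divide_right_mono mult_left_mono sum_mono less.IH) (use R m in auto)
      also have "\<dots> = C * (R * (\<Sum>l\<in>I. \<Sum>j\<le>m. norm (fps_nth (a i l) j) * R ^ j) / real n)"
        by (simp add: sum_distrib_right sum_distrib_left mult_ac)
      also have "\<dots> \<le> C * (R * S / real n)"
        by (intro mult_left_mono divide_right_mono S less.prems C0) (use R in auto)
      also have "\<dots> \<le> C * 1"
        by (intro mult_left_mono C0) (use n0 False in \<open>auto simp: field_simps\<close>)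
      finally show ?thesis by simp
    qed
  qed
  thus ?thesis using i by blast
qed

text \<open>Boundedness of the coefficients at radius r + 1 gives absolute summability at r by
  Abel's lemma, and r is arbitrary.\<close>

lemma fps_ode_coeff_conv_radius:
  assumes "finite I" and "i \<in> I"
    and "\<And>i l. i \<in> I \<Longrightarrow> l \<in> I \<Longrightarrow> fps_conv_radius (a i l) = \<infinity>"
  shows "fps_conv_radius (Abs_fps (\<lambda>n. ode_coeff a I y n i)) = \<infinity>"
proof -
  have "fps_conv_radius (Abs_fps (\<lambda>n. ode_coeff a I y n i)) \<ge> \<infinity>"
    unfolding fps_conv_radius_def
  proof (rule conv_radius_geI_ex)
    fix r :: real assume r: "0 < r"
    have "\<exists>C. \<forall>n. norm (ode_coeff a I y n i) * (r + 1) ^ n \<le> C"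
      using r by (intro ode_coeff_bounded assms) auto
    then obtain C where C: "\<And>n. norm (ode_coeff a I y n i) * (r + 1) ^ n \<le> C" by blast
    have "summable (\<lambda>n. norm (ode_coeff a I y n i) * r ^ n)"
      by (rule Abel_lemma[of _ "r + 1" _ C]) (use r C in auto)
    hence "summable (\<lambda>n. norm (ode_coeff a I y n i * of_real r ^ n))"
      using r by (simp add: norm_mult norm_power)
    hence "summable (\<lambda>n. ode_coeff a I y n i * of_real r ^ n)"
      by (rule summable_norm_cancel)
    thus "\<exists>z. norm z = r \<and> summable (\<lambda>n. fps_nth (Abs_fps (\<lambda>n. ode_coeff a I y n i)) n * z ^ n)"
      using r by (intro exI[of _ "of_real r :: complex"]) simp
  qed
  thus ?thesis by simp
qed

lemma eval_fps_sum:
  fixes f :: "'b \<Rightarrow> complex fps"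
  assumes "\<And>l. l \<in> I \<Longrightarrow> fps_conv_radius (f l) = \<infinity>"
  shows "fps_conv_radius (\<Sum>l\<in>I. f l) = \<infinity> \<and> eval_fps (\<Sum>l\<in>I. f l) z = (\<Sum>l\<in>I. eval_fps (f l) z)"
  using assms
proof (induction I rule: infinite_finite_induct)
  case (insert l I)
  have "fps_conv_radius (f l + sum f I) = \<infinity>"
    using fps_conv_radius_add[of "f l" "sum f I"] insert by simp
  thus ?case using insert by (simp add: eval_fps_add)
qed simp_all

text \<open>All radii of convergence are infinite, so the formal identity for the Cauchy products
  may be evaluated at every point. The solution is therefore global from the start.\<close>

lemma entire_linear_ode:
  fixes A :: "'a \<Rightarrow> 'a \<Rightarrow> complex \<Rightarrow> complex"
  assumes I: "finite I" and A: "\<And>i l. i \<in> I \<Longrightarrow> l \<in> I \<Longrightarrow> A i l holomorphic_on UNIV"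
  shows "\<exists>Y. \<forall>i\<in>I. Y i 0 = y i \<and>
    (\<forall>z. (Y i has_field_derivative (\<Sum>l\<in>I. A i l z * Y l z)) (at z))"
proof -
  define a where "a i l = fps_expansion (A i l) 0" for i l
  have rad: "fps_conv_radius (a i l) = \<infinity>" if "i \<in> I" "l \<in> I" for i l
    using conv_radius_fps_expansion[of "A i l" 0 \<infinity>] A[OF that] by (simp add: a_def)
  have ev: "eval_fps (a i l) z = A i l z" if "i \<in> I" "l \<in> I" for i l z
    using eval_fps_expansion'[of "A i l" 0 \<infinity> z] A[OF that] by (simp add: a_def)
  define F where "F i = Abs_fps (\<lambda>n. ode_coeff a I y n i)" for i
  have F: "fps_conv_radius (F i) = \<infinity>" if "i \<in> I" for i
    unfolding F_def by (rule fps_ode_coeff_conv_radius[OF I that rad])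
  have deriv_F: "fps_deriv (F i) = (\<Sum>l\<in>I. a i l * F l)" for i
  proof (rule fps_ext)
    fix n
    have "fps_nth (fps_deriv (F i)) n = of_nat (Suc n) * ode_coeff a I y (Suc n) i"
      by (simp add: F_def)
    also have "\<dots> = (\<Sum>l\<in>I. \<Sum>j\<le>n. fps_nth (a i l) j * ode_coeff a I y (n - j) l)"
      by (simp del: of_nat_Suc)
    also have "\<dots> = fps_nth (\<Sum>l\<in>I. a i l * F l) n"
      by (simp add: F_def fps_sum_nth fps_mult_nth atLeast0AtMost)
    finally show "fps_nth (fps_deriv (F i)) n = fps_nth (\<Sum>l\<in>I. a i l * F l) n" .
  qed
  have prod_rad: "fps_conv_radius (a i l * F l) = \<infinity>" if "i \<in> I" "l \<in> I" for i l
    using fps_conv_radius_mult[of "a i l" "F l"] rad F that by simp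
  have "(eval_fps (F i) has_field_derivative (\<Sum>l\<in>I. A i l z * eval_fps (F l) z)) (at z)"
    if i: "i \<in> I" for i z
  proof -
    have "(eval_fps (F i) has_field_derivative eval_fps (fps_deriv (F i)) z) (at z)"
      by (rule has_field_derivative_eval_fps) (simp add: F i)
    also have "eval_fps (fps_deriv (F i)) z = (\<Sum>l\<in>I. eval_fps (a i l * F l) z)"
      using eval_fps_sum[of I "\<lambda>l. a i l * F l" z] prod_rad i by (simp add: deriv_F)
    also have "\<dots> = (\<Sum>l\<in>I. A i l z * eval_fps (F l) z)"
      by (intro sum.cong refl) (simp add: eval_fps_mult rad F ev i)
    finally show ?thesis .
  qed
  moreover have "eval_fps (F i) 0 = y i" for i
    by (simp add: eval_fps_at_0 F_def)
  ultimately show ?thesis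
    by (intro exI[of _ "\<lambda>i. eval_fps (F i)"]) blast
qed

text \<open>
  Solutions \<open>G\<close> of the adjoint system \<open>G' = - A\<^sup>T G\<close> pair with solutions \<open>Y\<close> to constants; hence no
  nontrivial combination of the columns of \<open>Y\<close> vanishes at any point.
\<close>

lemma entire_fundamental_system:
  fixes A :: "'a \<Rightarrow> 'a \<Rightarrow> complex \<Rightarrow> complex"
  assumes I: "finite I" and A: "\<And>i l. i \<in> I \<Longrightarrow> l \<in> I \<Longrightarrow> A i l holomorphic_on UNIV"
  obtains Y where
    "\<And>i k z. i \<in> I \<Longrightarrow> k \<in> I \<Longrightarrow> (Y i k has_field_derivative (\<Sum>l\<in>I. A i l z * Y l k z)) (at z)"
    and "\<And>c z k. (\<And>i. i \<in> I \<Longrightarrow> (\<Sum>k\<in>I. c k * Y i k z) = 0) \<Longrightarrow> k \<in> I \<Longrightarrow> c k = 0"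
proof -
  have "\<forall>k. \<exists>Y. \<forall>i\<in>I. Y i 0 = (if i = k then 1 else 0) \<and>
      (\<forall>z. (Y i has_field_derivative (\<Sum>l\<in>I. A i l z * Y l z)) (at z))"
    by (intro allI entire_linear_ode I A)
  from choice[OF this] obtain Y
    where Y0: "\<And>i k. i \<in> I \<Longrightarrow> Y k i 0 = (if i = k then 1 else 0)"
    and Y: "\<And>i k z. i \<in> I \<Longrightarrow> (Y k i has_field_derivative (\<Sum>l\<in>I. A i l z * Y k l z)) (at z)"
    by blast
  have A': "(\<lambda>z. - A l i z) holomorphic_on UNIV" if "i \<in> I" "l \<in> I" for i l
    using A that by (intro holomorphic_intros)
  have "\<forall>k. \<exists>G. \<forall>i\<in>I. G i 0 = (if i = k then 1 else 0) \<and>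
      (\<forall>z. (G i has_field_derivative (\<Sum>l\<in>I. - A l i z * G l z)) (at z))"
    by (intro allI entire_linear_ode I A')
  from choice[OF this] obtain G
    where G0: "\<And>i k. i \<in> I \<Longrightarrow> G k i 0 = (if i = k then 1 else 0)"
    and G: "\<And>i k z. i \<in> I \<Longrightarrow> (G k i has_field_derivative (\<Sum>l\<in>I. - A l i z * G k l z)) (at z)"
    by blast
  have pairing: "(\<Sum>i\<in>I. G j i z * Y k i z) = (if j = k then 1 else 0)" if jk: "j \<in> I" "k \<in> I" for j k z
  proof -
    have "((\<lambda>z. \<Sum>i\<in>I. G j i z * Y k i z) has_field_derivative 0) (at z)" for z
    proof -
      have "((\<lambda>z. \<Sum>i\<in>I. G j i z * Y k i z) has_field_derivative
          (\<Sum>i\<in>I. (\<Sum>l\<in>I. - A l i z * G j l z) * Y k i z + (\<Sum>l\<in>I. A i l z * Y k l z) * G j i z)) (at z)"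
        by (intro DERIV_sum DERIV_mult G Y)
      also have "(\<Sum>i\<in>I. (\<Sum>l\<in>I. - A l i z * G j l z) * Y k i z + (\<Sum>l\<in>I. A i l z * Y k l z) * G j i z)
          = (\<Sum>i\<in>I. \<Sum>l\<in>I. A i l z * Y k l z * G j i z) - (\<Sum>i\<in>I. \<Sum>l\<in>I. A l i z * Y k i z * G j l z)"
        by (simp add: sum.distrib sum_distrib_right sum_distrib_left sum_negf sum_subtractf algebra_simps)
      also have "(\<Sum>i\<in>I. \<Sum>l\<in>I. A l i z * Y k i z * G j l z) = (\<Sum>i\<in>I. \<Sum>l\<in>I. A i l z * Y k l z * G j i z)"
        by (rule sum.swap)
      finally show ?thesis by simp
    qed
    then obtain c where c: "\<And>z. (\<Sum>i\<in>I. G j i z * Y k i z) = c"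
      using has_field_derivative_zero_constant[of UNIV "\<lambda>z. \<Sum>i\<in>I. G j i z * Y k i z"] by auto
    have "c = (\<Sum>i\<in>I. if i = j then (if j = k then 1 else 0) else 0)"
      unfolding c[of 0, symmetric] by (intro sum.cong) (auto simp: G0 Y0)
    thus ?thesis using c I jk by simp
  qed
  show thesis
  proof
    show "(Y k i has_field_derivative (\<Sum>l\<in>I. A i l z * Y k l z)) (at z)" if "i \<in> I" "k \<in> I" for i k z
      by (rule Y[OF that(1)])
    fix c z j assume c: "\<And>i. i \<in> I \<Longrightarrow> (\<Sum>k\<in>I. c k * Y k i z) = 0" and j: "j \<in> I"
    \<comment> \<open>By \<open>pairing\<close>, the vectors \<open>G j\<close> are the rows of a
      left inverse of the solution matrix; applying one of them isolates a single
      coefficient.\<close>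
    have "c j = (\<Sum>k\<in>I. c k * (\<Sum>i\<in>I. G j i z * Y k i z))"
      using I j by (simp add: pairing if_distrib cong: if_cong)
    also have "\<dots> = (\<Sum>i\<in>I. G j i z * (\<Sum>k\<in>I. c k * Y k i z))"
      unfolding sum_distrib_left by (subst sum.swap) (simp add: mult_ac)
    also have "\<dots> = 0" by (simp add: c)
    finally show "c j = 0" .
  qed
qed

section \<open>Recurrences with a compatible differential operator\<close>

text \<open>One form for both families, with \<open>s\<close> the place of the term multiplied by z.
  Row \<open>n + d\<close> of a band matrix begins at column n and has its diagonal at
  \<open>s = d\<close>; column \<open>n + 1\<close> begins at row n and has its diagonal at
  \<open>s = 1\<close>. Starting there avoids every truncated equation.\<close>

definition solves_recurrence ::
  "(nat \<Rightarrow> nat \<Rightarrow> complex) \<Rightarrow> nat \<Rightarrow> nat \<Rightarrow> complex \<Rightarrow> (nat \<Rightarrow> complex) \<Rightarrow> bool" where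
  "solves_recurrence C d s z f \<longleftrightarrow> (\<forall>n. (\<Sum>k\<le>Suc d. C n k * f (n + k)) = z * f (n + s))"

lemma solves_recurrence_sum:
  assumes "\<And>k. k \<in> K \<Longrightarrow> solves_recurrence C d s z (f k)"
  shows "solves_recurrence C d s z (\<lambda>n. \<Sum>k\<in>K. c k * f k n)"
proof -
  have "(\<Sum>j\<le>Suc d. C n j * (\<Sum>k\<in>K. c k * f k (n + j))) = z * (\<Sum>k\<in>K. c k * f k (n + s))" for n
  proof -
    have "(\<Sum>j\<le>Suc d. C n j * (\<Sum>k\<in>K. c k * f k (n + j)))
        = (\<Sum>k\<in>K. c k * (\<Sum>j\<le>Suc d. C n j * f k (n + j)))"
      unfolding sum_distrib_left by (subst sum.swap) (simp only: mult_ac)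
    also have "\<dots> = (\<Sum>k\<in>K. c k * (z * f k (n + s)))"
      using assms unfolding solves_recurrence_def by (intro sum.cong refl) simp
    finally show ?thesis by (simp add: sum_distrib_left mult_ac)
  qed
  thus ?thesis by (simp add: solves_recurrence_def)
qed

text \<open>The recurrence of order \<open>d + 1\<close> as a one-step map on windows: entry i of
  window n stands for f (n + i). Entries beyond d carry no information and never feed back when
  \<open>s \<le> d\<close>.\<close>

primrec recurrence_window ::
  "(nat \<Rightarrow> nat \<Rightarrow> complex) \<Rightarrow> nat \<Rightarrow> nat \<Rightarrow> complex \<Rightarrow> (nat \<Rightarrow> complex) \<Rightarrow> nat \<Rightarrow> nat \<Rightarrow> complex" where
  "recurrence_window C d s z y 0 = y"
| "recurrence_window C d s z y (Suc n) = (\<lambda>i.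
     if i < d then recurrence_window C d s z y n (Suc i)
     else (z * recurrence_window C d s z y n s - (\<Sum>k\<le>d. C n k * recurrence_window C d s z y n k))
       / C n (Suc d))"

text \<open>The bounds on \<open>s\<close> keep z away from the two extreme terms, so solving for
  either of them divides by a nonzero constant and preserves holomorphy in z.\<close>

locale two_sided_recurrence =
  fixes C :: "nat \<Rightarrow> nat \<Rightarrow> complex" and d s :: nat
  assumes first: "\<And>n. C n 0 \<noteq> 0" and last: "\<And>n. C n (Suc d) \<noteq> 0"
    and s_pos: "1 \<le> s" and s_le: "s \<le> d"
begin

abbreviation solves :: "complex \<Rightarrow> (nat \<Rightarrow> complex) \<Rightarrow> bool" where
  "solves \<equiv> solves_recurrence C d s"

text \<open>A zero window moves one place up or down because both extreme coefficients are nonzero.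
  So a zero window anywhere is equivalent to one at 0, and hence to one at every index.\<close>

lemma solves_eq_0:
  assumes f: "solves z f" and M: "\<And>i. i \<le> d \<Longrightarrow> f (M + i) = 0"
  shows "f n = 0"
proof -
  have eq: "(\<Sum>k\<le>d. C M k * f (M + k)) + C M (Suc d) * f (M + Suc d) = z * f (M + s)" for M
    using f by (simp add: solves_recurrence_def)
  have step: "(\<forall>i\<le>d. f (Suc M + i) = 0) \<longleftrightarrow> (\<forall>i\<le>d. f (M + i) = 0)" for M
  proof
    assume *: "\<forall>i\<le>d. f (M + i) = 0"
    have "C M (Suc d) * f (M + Suc d) = 0"
      using eq[of M] * s_le by simp
    hence "f (M + Suc d) = 0" using last by simp
    hence "f (M + i) = 0" if "i \<le> Suc d" for i
      using * that le_Suc_eq by auto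
    from this[of "Suc i" for i] show "\<forall>i\<le>d. f (Suc M + i) = 0" by simp
  next
    assume *: "\<forall>i\<le>d. f (Suc M + i) = 0"
    have **: "f (M + i) = 0" if "1 \<le> i" "i \<le> Suc d" for i
      using *[rule_format, of "i - 1"] that by simp
    have "C M 0 * f M = 0"
      using eq[of M] * **[of s] s_pos s_le by (subst (asm) sum.atMost_shift) simp
    hence "f M = 0" using first by simp
    thus "\<forall>i\<le>d. f (M + i) = 0" using ** by (metis One_nat_def Suc_leI add.right_neutral le_SucI neq0_conv)
  qed
  have "(\<forall>i\<le>d. f (M + i) = 0) \<longleftrightarrow> (\<forall>i\<le>d. f (0 + i) = 0)" for M
    by (induction M) (use step in auto)
  hence "\<forall>i\<le>d. f (n + i) = 0" using M by blast
  thus ?thesis by (metis add.right_neutral le0)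
qed

text \<open>Forward extension settles the case of a window at 0. Induction on M handles later
  windows by moving the prescribed data one place back.\<close>

lemma solves_extend:
  assumes "\<And>i. (\<lambda>z. y i z) holomorphic_on UNIV"
  shows "\<exists>F. (\<forall>n. F n holomorphic_on UNIV) \<and> (\<forall>z. solves z (\<lambda>n. F n z)) \<and>
    (\<forall>i\<le>d. \<forall>z. F (M + i) z = y i z)"
  using assms
proof (induction M arbitrary: y)
  case 0
  note y = 0
  define W where "W n i z = recurrence_window C d s z (\<lambda>i. y i z) n i" for n i z
  have W_0: "W 0 i z = y i z" for i z by (simp add: W_def)
  have W_Suc: "W (Suc n) i z = (if i < d then W n (Suc i) z
      else (z * W n s z - (\<Sum>k\<le>d. C n k * W n k z)) / C n (Suc d))" for n i z
    by (simp add: W_def)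
  have hol: "W n i holomorphic_on UNIV" for n i
  proof (induction n arbitrary: i)
    case 0
    show ?case using y by (simp add: W_0 cong: holomorphic_cong)
  next
    case (Suc n)
    show ?case
    proof (cases "i < d")
      case True
      thus ?thesis using Suc[of "Suc i"] by (simp add: W_Suc cong: holomorphic_cong)
    next
      case False
      have "(\<lambda>z. (z * W n s z - (\<Sum>k\<le>d. C n k * W n k z)) / C n (Suc d)) holomorphic_on UNIV"
        by (intro holomorphic_intros Suc) (simp add: last)
      thus ?thesis using False by (simp add: W_Suc cong: holomorphic_cong)
    qed
  qed
  have shift: "W (n + i) 0 z = W n i z" if "i \<le> d" for n i z
    using that
  proof (induction i arbitrary: n)
    case (Suc i)
    show ?case using Suc.IH[of "Suc n"] Suc.prems by (simp add: W_Suc)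
  qed simp
  have "solves z (\<lambda>n. W n 0 z)" for z
  proof -
    have "(\<Sum>k\<le>Suc d. C n k * W (n + k) 0 z) = z * W (n + s) 0 z" for n
    proof -
      have "W (n + Suc d) 0 z = W (Suc n) d z"
        using shift[of d "Suc n"] by simp
      thus ?thesis using last s_le by (simp add: shift W_Suc)
    qed
    thus ?thesis by (simp add: solves_recurrence_def)
  qed
  thus ?case using hol shift[of _ 0] by (intro exI[of _ "\<lambda>n. W n 0"]) (auto simp: W_0)
next
  case (Suc M)
  \<comment> \<open>With \<open>y\<close> prescribed at M + 1, ..., M + 1 + d, entry 0 is the
    recurrence at M solved for f M, and f (M + s) is \<open>y (s - 1)\<close>. The shifted window no
    longer contains \<open>y d\<close>; the same recurrence returns this value in
    \<open>top\<close>.\<close>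
  define y' where "y' i z = (if i = 0
      then (z * y (s - 1) z - (\<Sum>k\<le>d. C M (Suc k) * y k z)) / C M 0 else y (i - 1) z)" for i z
  have "y' i holomorphic_on UNIV" for i
  proof (cases "i = 0")
    case True
    have "(\<lambda>z. (z * y (s - 1) z - (\<Sum>k\<le>d. C M (Suc k) * y k z)) / C M 0) holomorphic_on UNIV"
      by (intro holomorphic_intros Suc.prems) (simp add: first)
    thus ?thesis using True by (simp add: y'_def cong: holomorphic_cong)
  qed (use Suc.prems in \<open>simp add: y'_def cong: holomorphic_cong\<close>)
  from Suc.IH[of y', OF this] obtain F where F: "\<And>n. F n holomorphic_on UNIV"
    "\<And>z. solves z (\<lambda>n. F n z)" "\<And>i z. i \<le> d \<Longrightarrow> F (M + i) z = y' i z" by blast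
  have low: "F (Suc M + i) z = y i z" if "i < d" for i z
    using F(3)[of "Suc i" z] that by (simp add: y'_def)
  have top: "F (Suc M + d) z = y d z" for z
  proof -
    have "C M 0 * F M z + (\<Sum>k\<le>d. C M (Suc k) * F (Suc M + k) z) = z * F (M + s) z"
      using F(2)[of z] unfolding solves_recurrence_def
      by (subst (asm) sum.atMost_Suc_shift) simp
    moreover have "C M 0 * F M z = z * y (s - 1) z - (\<Sum>k\<le>d. C M (Suc k) * y k z)"
      using F(3)[of 0 z] first by (simp add: y'_def)
    moreover have "F (M + s) z = y (s - 1) z"
      using F(3)[of s z] s_pos s_le by (simp add: y'_def)
    moreover have "(\<Sum>k\<le>d. g k) = (\<Sum>k<d. g k) + g d" for g :: "nat \<Rightarrow> complex"
      by (simp add: lessThan_Suc_atMost[symmetric])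
    ultimately have "C M (Suc d) * F (Suc M + d) z = C M (Suc d) * y d z"
      using low by simp
    thus ?thesis using last by simp
  qed
  have "F (Suc M + i) z = y i z" if "i \<le> d" for i z
    using low[of i z] top[of z] that by (cases "i = d") auto
  thus ?case using F(1,2) by blast
qed

text \<open>
  Prescribing the window at \<open>m\<close> turns \<open>f' = L f\<close> into a finite linear differential system for that
  window; compatibility of \<open>L\<close> with the recurrence carries the differential equation to all
  larger indices.
\<close>

lemma compatible_system_solutions:
  fixes B :: "nat \<Rightarrow> nat \<Rightarrow> complex" and w :: "nat \<Rightarrow> nat"
  defines "L \<equiv> \<lambda>f n. \<Sum>l\<le>w n. B n l * f l"
  assumes compat: "\<And>z f n. solves z f \<Longrightarrow> m \<le> n \<Longrightarrow>
    (\<Sum>k\<le>Suc d. C n k * L f (n + k)) = z * L f (n + s) + f (n + s)"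
  shows "\<exists>f. (\<forall>k z. solves z (\<lambda>n. f k n z)) \<and>
    (\<forall>k\<le>d. \<forall>n\<ge>m. \<forall>z. (f k n has_field_derivative L (\<lambda>n. f k n z) n) (at z)) \<and>
    (\<forall>z M c. (\<forall>i\<le>d. (\<Sum>k\<le>d. c k * f k (M + i) z) = 0) \<longrightarrow> (\<forall>k\<le>d. c k = 0))"
proof -
  have "\<forall>k. \<exists>F. (\<forall>n. F n holomorphic_on UNIV) \<and> (\<forall>z. solves z (\<lambda>n. F n z)) \<and>
    (\<forall>i\<le>d. \<forall>z. F (m + i) z = (if i = k then 1 else 0))"
    by (intro allI solves_extend) simp
  from choice[OF this] obtain e where e: "\<And>k n. e k n holomorphic_on UNIV"
    "\<And>k z. solves z (\<lambda>n. e k n z)"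
    "\<And>k i z. i \<le> d \<Longrightarrow> e k (m + i) z = (if i = k then 1 else 0)"
    by blast
  \<comment> \<open>The \<open>e k\<close> have unit vectors as windows at m. Expanding a solution
    in them turns \<open>L\<close> into a finite matrix acting on that window, although
    \<open>L\<close> uses values outside it.\<close>
  define A where "A i k z = L (\<lambda>n. e k n z) (m + i)" for i k z
  have A: "A i k holomorphic_on UNIV" for i k
    unfolding A_def L_def by (intro holomorphic_intros e)
  obtain Y where Y:
    "\<And>i k z. i \<in> {..d} \<Longrightarrow> k \<in> {..d} \<Longrightarrow>
       (Y i k has_field_derivative (\<Sum>l\<in>{..d}. A i l z * Y l k z)) (at z)"
    and ker: "\<And>c z k. (\<And>i. i \<in> {..d} \<Longrightarrow> (\<Sum>k\<in>{..d}. c k * Y i k z) = 0) \<Longrightarrow> k \<in> {..d} \<Longrightarrow> c k = 0"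
    using entire_fundamental_system[of "{..d}" A] A by blast
  define f where "f k n z = (\<Sum>l\<le>d. Y l k z * e l n z)" for k n z
  have f: "solves z (\<lambda>n. f k n z)" for k z
    unfolding f_def by (rule solves_recurrence_sum) (rule e)
  have f_m: "f k (m + i) z = Y i k z" if "i \<le> d" for k i z
    using that by (simp add: f_def e(3) if_distrib cong: if_cong)
  have Lf: "L (\<lambda>n. f k n z) (m + i) = (\<Sum>l\<le>d. A i l z * Y l k z)" for k i z
    unfolding A_def L_def f_def sum_distrib_left sum_distrib_right
    by (subst sum.swap) (simp add: mult_ac)
  have deriv: "(f k n has_field_derivative L (\<lambda>n. f k n z) n) (at z)"
    if "k \<le> d" "m \<le> n" for k n z
    using that(2)
  proof (induction n arbitrary: z rule: less_induct)
    case (less n)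
    show ?case
    proof (cases "n \<le> m + d")
      case True
      then obtain i where i: "n = m + i" "i \<le> d" using less.prems by (metis le_Suc_ex nat_add_left_cancel_le)
      have "f k n = Y i k" using f_m i by auto
      thus ?thesis using Y[of i k z] i that(1) by (simp add: Lf)
    next
      case False
      \<comment> \<open>The recurrence at \<open>q\<close> has n as its last index, so all other
        derivatives in it are known. Differentiating the factor z produces an extra f (q + s), which
        is exactly the inhomogeneous term in \<open>compat\<close>.\<close>
      define q where "q = n - Suc d"
      have q: "n = q + Suc d" "m \<le> q" using False by (auto simp: q_def)
      have IH: "(f k (q + j) has_field_derivative L (\<lambda>n. f k n z) (q + j)) (at z)" if "j \<le> d" for j
        using less.IH[of "q + j" z] that q by simp
      have eq: "f k n = (\<lambda>z. (z * f k (q + s) z - (\<Sum>j\<le>d. C q j * f k (q + j) z)) / C q (Suc d))"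
      proof
        fix z
        have "(\<Sum>j\<le>d. C q j * f k (q + j) z) + C q (Suc d) * f k n z = z * f k (q + s) z"
          using f[of z k] by (simp add: solves_recurrence_def q)
        thus "f k n z = (z * f k (q + s) z - (\<Sum>j\<le>d. C q j * f k (q + j) z)) / C q (Suc d)"
          using last[of q] by (simp add: field_simps)
      qed
      have "(f k n has_field_derivative
          ((1 * f k (q + s) z + L (\<lambda>n. f k n z) (q + s) * z)
            - (\<Sum>j\<le>d. C q j * L (\<lambda>n. f k n z) (q + j))) / C q (Suc d)) (at z)"
        unfolding eq using s_le
        by (intro DERIV_cdivide DERIV_diff DERIV_mult DERIV_ident DERIV_sum DERIV_cmult IH) auto
      moreover have "(\<Sum>j\<le>d. C q j * L (\<lambda>n. f k n z) (q + j)) + C q (Suc d) * L (\<lambda>n. f k n z) n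
          = z * L (\<lambda>n. f k n z) (q + s) + f k (q + s) z"
        using compat[OF f q(2), of k z] q(1) by simp
      hence "((1 * f k (q + s) z + L (\<lambda>n. f k n z) (q + s) * z)
            - (\<Sum>j\<le>d. C q j * L (\<lambda>n. f k n z) (q + j))) / C q (Suc d) = L (\<lambda>n. f k n z) n"
        using last[of q] by (simp add: field_simps)
      ultimately show ?thesis by simp
    qed
  qed
  \<comment> \<open>By \<open>solves_eq_0\<close>, a combination vanishing on the window at M also
    vanishes on the window at m, where the solutions coincide with \<open>Y\<close>.\<close>
  have "c k = 0" if "\<forall>i\<le>d. (\<Sum>k\<le>d. c k * f k (M + i) z) = 0" "k \<le> d" for z M c k
  proof (rule ker[of c z])
    fix i assume i: "i \<in> {..d}"
    have "(\<Sum>k\<le>d. c k * f k (m + i) z) = 0"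
      by (rule solves_eq_0[OF solves_recurrence_sum[OF f], where M = M]) (use that(1) in simp)
    thus "(\<Sum>k\<in>{..d}. c k * Y i k z) = 0" using i f_m by simp
  qed (use that in simp)
  with f deriv show ?thesis by (intro exI[of _ f]) blast
qed

end

section \<open>Band matrices and the string equation\<close>

text \<open>
  \<open>band d\<^sub>2 \<alpha> n m\<close> is the coefficient of \<open>\<psi>\<^sub>m\<close> in \<open>x \<psi>\<^sub>n\<close>, and \<open>- band d\<^sub>1 \<beta> m n\<close> the one in \<open>\<partial>\<^sub>x \<psi>\<^sub>n\<close>.
\<close>

definition band :: "nat \<Rightarrow> (int \<Rightarrow> int \<Rightarrow> complex) \<Rightarrow> nat \<Rightarrow> nat \<Rightarrow> complex" where
  "band d c n m = (if int n - int m \<in> {- 1..int d} then c (int n - int m) (int n) else 0)"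

text \<open>Any \<open>U\<close> beyond the end of the band gives the same sum. This freedom lets
  finite sums stand for products of infinite band matrices.\<close>

lemma sum_band_row:
  assumes "n + 1 \<le> U"
  shows "(\<Sum>j\<in>{j\<in>{- 1..int d}. 0 \<le> int n - j}. c j (int n) * g (nat (int n - j)))
    = (\<Sum>m\<le>U. band d c n m * g m)"
proof -
  have "(\<Sum>m\<le>U. band d c n m * g m)
      = (\<Sum>m\<in>{m. m \<le> U \<and> int n - int m \<in> {- 1..int d}}. c (int n - int m) (int n) * g m)"
    by (rule sum.mono_neutral_cong_right) (auto simp: band_def)
  also have "\<dots> = (\<Sum>j\<in>{j\<in>{- 1..int d}. 0 \<le> int n - j}. c j (int n) * g (nat (int n - j)))"
    by (rule sum.reindex_bij_witness[where i = "\<lambda>j. nat (int n - j)" and j = "\<lambda>m. int n - int m"])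
      (use assms in auto)
  finally show ?thesis ..
qed

lemma sum_band_column:
  assumes "n + e \<le> U"
  shows "(\<Sum>j\<in>{j\<in>{- 1..int e}. 0 \<le> int n + j}. b j (int n + j) * g (nat (int n + j)))
    = (\<Sum>m\<le>U. band e b m n * g m)"
proof -
  have "(\<Sum>m\<le>U. band e b m n * g m)
      = (\<Sum>m\<in>{m. m \<le> U \<and> int m - int n \<in> {- 1..int e}}. b (int m - int n) (int m) * g m)"
    by (rule sum.mono_neutral_cong_right) (auto simp: band_def)
  also have "\<dots> = (\<Sum>j\<in>{j\<in>{- 1..int e}. 0 \<le> int n + j}. b j (int n + j) * g (nat (int n + j)))"
    by (rule sum.reindex_bij_witness[where i = "\<lambda>j. nat (int n + j)" and j = "\<lambda>m. int m - int n"])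
      (use assms in auto)
  finally show ?thesis ..
qed

section \<open>Linear independence of the quasi-polynomials\<close>

lemma monic_polys_independent:
  fixes p :: "nat \<Rightarrow> complex poly"
  assumes p: "\<And>n. degree (p n) = n" "\<And>n. lead_coeff (p n) = 1"
    and "(\<Sum>m\<le>U. Polynomial.smult (a m) (p m)) = 0" and "m \<le> U"
  shows "a m = 0"
  using assms(3,4)
proof (induction U)
  case 0
  have "p 0 \<noteq> 0" using p(2)[of 0] by auto
  thus ?case using 0 by simp
next
  case (Suc U)
  have "coeff (\<Sum>m\<le>Suc U. Polynomial.smult (a m) (p m)) (Suc U) = (\<Sum>m\<le>Suc U. a m * coeff (p m) (Suc U))"
    by (simp add: coeff_sum)
  also have "(\<Sum>m\<le>U. a m * coeff (p m) (Suc U)) = 0"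
    by (intro sum.neutral ballI) (simp add: coeff_eq_0 p(1))
  hence "(\<Sum>m\<le>Suc U. a m * coeff (p m) (Suc U)) = a (Suc U)"
    using p[of "Suc U"] by simp
  finally have top: "a (Suc U) = 0" unfolding Suc.prems(1) by simp
  hence "(\<Sum>m\<le>U. Polynomial.smult (a m) (p m)) = 0" using Suc.prems(1) by simp
  thus ?case using Suc.IH Suc.prems(2) top by (cases "m = Suc U") auto
qed

lemma sum_quasi_poly:
  "(\<Sum>m\<le>U. a m * quasi_poly V p r m x) = poly (\<Sum>m\<le>U. Polynomial.smult (a m / r m) (p m)) x * exp (- V x)"
  unfolding quasi_poly_def poly_sum sum_distrib_right by (intro sum.cong) auto

lemma quasi_polys_independent:
  assumes p: "\<And>n. degree (p n) = n" "\<And>n. lead_coeff (p n) = 1" and r: "\<And>n. r n \<noteq> 0"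
    and 0: "\<And>x. (\<Sum>m\<le>U. a m * quasi_poly V p r m x) = 0" and m: "m \<le> U"
  shows "a m = 0"
proof -
  have "poly (\<Sum>m\<le>U. Polynomial.smult (a m / r m) (p m)) x = 0" for x
    using 0[of x] by (simp add: sum_quasi_poly)
  hence "(\<Sum>m\<le>U. Polynomial.smult (a m / r m) (p m)) = 0"
    using poly_all_0_iff_0 by blast
  from monic_polys_independent[OF p this m] show ?thesis using r by simp
qed

section \<open>Leading coefficients and the commutator identity for one family\<close>

definition potential_poly :: "nat \<Rightarrow> (nat \<Rightarrow> complex) \<Rightarrow> complex poly" where
  "potential_poly d u = (\<Sum>K = 1..d+1. monom (u K / of_nat K) K)"

lemma poly_potential_poly: "poly (potential_poly d u) = potential d u"
  by (auto simp: potential_poly_def potential_def poly_sum poly_monom)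

lemma coeff_pderiv_potential_poly:
  "coeff (pderiv (potential_poly d u)) k = (if k \<le> d then u (Suc k) else 0)"
proof -
  have "coeff (potential_poly d u) (Suc k)
      = (\<Sum>K = 1..d+1. if Suc k = K then u K / of_nat K else 0)"
    by (simp only: potential_poly_def coeff_sum coeff_monom eq_commute)
  also have "\<dots> = (if k \<le> d then u (Suc k) / of_nat (Suc k) else 0)"
    by (subst sum.delta') auto
  finally show ?thesis by (simp add: coeff_pderiv del: of_nat_Suc)
qed

lemma degree_pderiv_potential_poly:
  assumes "u (d + 1) \<noteq> 0"
  shows "degree (pderiv (potential_poly d u)) = d"
  using assms by (intro antisym degree_le le_degree) (auto simp: coeff_pderiv_potential_poly)

lemma quasi_poly_has_derivative:
  "(quasi_poly (potential d u) p r n has_field_derivative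
     poly (pderiv (p n) - pderiv (potential_poly d u) * p n) x * exp (- potential d u x) / r n) (at x)"
proof -
  let ?V = "potential_poly d u"
  have "((\<lambda>x. poly (p n) x * exp (- poly ?V x)) has_field_derivative
      poly (pderiv (p n) - pderiv ?V * p n) x * exp (- poly ?V x)) (at x)"
    by (rule derivative_eq_intros poly_DERIV refl)+ (simp add: algebra_simps)
  from DERIV_cdivide[OF this, of "r n"] show ?thesis
    unfolding quasi_poly_def poly_potential_poly .
qed

locale quasi_poly_recursion =
  fixes d e :: nat and c b :: "int \<Rightarrow> int \<Rightarrow> complex" and u :: "nat \<Rightarrow> complex"
    and p :: "nat \<Rightarrow> complex poly" and r :: "nat \<Rightarrow> complex" and \<psi> :: "nat \<Rightarrow> complex \<Rightarrow> complex"
  defines "\<psi> \<equiv> quasi_poly (potential e u) p r"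
  assumes e: "1 \<le> e" and u: "u (e + 1) \<noteq> 0"
    and p: "\<And>n. degree (p n) = n" "\<And>n. lead_coeff (p n) = 1" and r: "\<And>n. r n \<noteq> 0"
    and mult: "\<And>n x. x * \<psi> n x =
       (\<Sum>j\<in>{j\<in>{- 1..int d}. 0 \<le> int n - j}. c j (int n) * \<psi> (nat (int n - j)) x)"
    and deriv: "\<And>n x. deriv (\<psi> n) x =
       - (\<Sum>j\<in>{j\<in>{- 1..int e}. 0 \<le> int n + j}. b j (int n + j) * \<psi> (nat (int n + j)) x)"
begin

lemma mult_band: "n + 1 \<le> U \<Longrightarrow> x * \<psi> n x = (\<Sum>m\<le>U. band d c n m * \<psi> m x)"
  unfolding mult by (rule sum_band_row)

lemma deriv_band: "n + e \<le> U \<Longrightarrow> deriv (\<psi> n) x = - (\<Sum>m\<le>U. band e b m n * \<psi> m x)"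
  unfolding deriv by (subst sum_band_column) auto

lemma has_deriv: "(\<psi> n has_field_derivative deriv (\<psi> n) x) (at x)"
  using quasi_poly_has_derivative[of e u p r n x] unfolding \<psi>_def
  by (metis DERIV_imp_deriv)

text \<open>In the derivative relation divided by the exponential, compare coefficients at degree n
  + e. The left side contributes -u (e + 1) / r n through V' times the monic \<open>p n\<close>; on
  the right only m = n + e has that degree. The result later makes the other family's recurrence
  solvable backwards.\<close>

lemma top_coeff_nonzero: "b (int e) (int (n + e)) \<noteq> 0"
proof -
  let ?V = "pderiv (potential_poly e u)"
  have "poly (Polynomial.smult (1 / r n) (pderiv (p n) - ?V * p n)) x
      = poly (- (\<Sum>m\<le>n + e. Polynomial.smult (band e b m n / r m) (p m))) x" for x
  proof -
    have "poly (pderiv (p n) - ?V * p n) x * exp (- potential e u x) / r n = deriv (\<psi> n) x"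
      unfolding \<psi>_def by (rule DERIV_imp_deriv[OF quasi_poly_has_derivative, symmetric])
    also have "\<dots> = - (\<Sum>m\<le>n + e. band e b m n * \<psi> m x)"
      by (rule deriv_band) simp
    also have "\<dots> = - poly (\<Sum>m\<le>n + e. Polynomial.smult (band e b m n / r m) (p m)) x * exp (- potential e u x)"
      unfolding \<psi>_def sum_quasi_poly by simp
    finally have "poly (pderiv (p n) - ?V * p n) x / r n * exp (- potential e u x)
        = - poly (\<Sum>m\<le>n + e. Polynomial.smult (band e b m n / r m) (p m)) x * exp (- potential e u x)"
      by simp
    hence "poly (pderiv (p n) - ?V * p n) x / r n
        = - poly (\<Sum>m\<le>n + e. Polynomial.smult (band e b m n / r m) (p m)) x"
      by (simp only: mult_right_cancel exp_not_eq_zero not_False_eq_True)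
    thus ?thesis by simp
  qed
  hence "coeff (Polynomial.smult (1 / r n) (pderiv (p n) - ?V * p n)) (n + e)
      = coeff (- (\<Sum>m\<le>n + e. Polynomial.smult (band e b m n / r m) (p m))) (n + e)"
    by (intro arg_cong[where f = "\<lambda>q. coeff q (n + e)"] poly_ext)
  moreover have "coeff (Polynomial.smult (1 / r n) (pderiv (p n) - ?V * p n)) (n + e) = - u (e + 1) / r n"
  proof -
    have "degree ?V = e" using u by (rule degree_pderiv_potential_poly)
    moreover have "coeff ?V e = u (e + 1)"
      unfolding coeff_pderiv_potential_poly by simp
    moreover have "coeff (p n) n = 1" using p(1)[of n] p(2)[of n] by simp
    ultimately have "coeff (?V * p n) (n + e) = u (e + 1)"
      using coeff_mult_degree_sum[of ?V "p n"] p(1)[of n] by (simp add: add.commute)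
    moreover have "coeff (pderiv (p n)) (n + e) = 0"
      using e p(1)[of n] by (simp add: coeff_pderiv coeff_eq_0)
    ultimately show ?thesis by simp
  qed
  moreover have "coeff (- (\<Sum>m\<le>n + e. Polynomial.smult (band e b m n / r m) (p m))) (n + e)
      = - (b (int e) (int (n + e)) / r (n + e))"
  proof -
    have "coeff (p (n + e)) (n + e) = 1"
      using p(1)[of "n + e"] p(2)[of "n + e"] by simp
    hence *: "band e b m n / r m * coeff (p m) (n + e)
        = (if m = n + e then b (int e) (int (n + e)) / r (n + e) else 0)" if "m \<le> n + e" for m
      using that by (cases "m = n + e") (simp_all add: coeff_eq_0 p(1) band_def)
    have "coeff (- (\<Sum>m\<le>n + e. Polynomial.smult (band e b m n / r m) (p m))) (n + e)
        = - (\<Sum>m\<le>n + e. band e b m n / r m * coeff (p m) (n + e))"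
      by (simp add: coeff_sum)
    also have "(\<Sum>m\<le>n + e. band e b m n / r m * coeff (p m) (n + e))
        = (\<Sum>m\<le>n + e. if m = n + e then b (int e) (int (n + e)) / r (n + e) else 0)"
      by (intro sum.cong refl *) simp
    finally show ?thesis by simp
  qed
  ultimately show ?thesis using u r by auto
qed

text \<open>
  Differentiating the multiplication rule gives \<open>[B\<^sup>T, A] = 1\<close> for the band matrices \<open>A\<close> and \<open>B\<close>
  of the two recursions, read off by linear independence of the \<open>\<psi>\<^sub>n\<close>.
\<close>

lemma string_equation:
  assumes U: "n + e + 1 \<le> U"
  shows "(\<Sum>l\<le>U. band e b l n * band d c l m) - (\<Sum>l\<le>U. band d c n l * band e b m l)
    = of_bool (m = n)"
proof -
  let ?A = "band d c" and ?B = "band e b"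
  \<comment> \<open>Rows of \<open>A\<close> and columns of \<open>B\<close> with index at most
    \<open>U\<close> end by U + 1 and U + e, so \<open>W\<close> contains all of them; adding m puts
    the wanted coefficient in range.\<close>
  define W where "W = U + e + 1 + m"
  have "(\<Sum>m\<le>W. ((\<Sum>l\<le>U. ?B l n * ?A l m) - (\<Sum>l\<le>U. ?A n l * ?B m l) - of_bool (m = n)) * \<psi> m x) = 0" for x
  proof -
    have "((\<lambda>x. x * \<psi> n x) has_field_derivative 1 * \<psi> n x + deriv (\<psi> n) x * x) (at x)"
      by (intro DERIV_mult DERIV_ident has_deriv)
    moreover have "((\<lambda>x. \<Sum>l\<le>U. ?A n l * \<psi> l x) has_field_derivative (\<Sum>l\<le>U. ?A n l * deriv (\<psi> l) x)) (at x)"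
      by (intro DERIV_sum DERIV_cmult has_deriv)
    moreover have "(\<lambda>x. x * \<psi> n x) = (\<lambda>x. \<Sum>l\<le>U. ?A n l * \<psi> l x)"
      by (intro ext mult_band) (use U in simp)
    ultimately have 1: "\<psi> n x + deriv (\<psi> n) x * x = (\<Sum>l\<le>U. ?A n l * deriv (\<psi> l) x)"
      using DERIV_unique by fastforce
    have "(\<Sum>l\<le>U. ?A n l * deriv (\<psi> l) x) = (\<Sum>l\<le>U. ?A n l * - (\<Sum>m\<le>W. ?B m l * \<psi> m x))"
      by (intro sum.cong refl arg_cong2[where f = "(*)"] deriv_band) (auto simp: W_def)
    also have "\<dots> = - (\<Sum>m\<le>W. (\<Sum>l\<le>U. ?A n l * ?B m l) * \<psi> m x)"
      unfolding sum_distrib_left sum_distrib_right mult_minus_right sum_negf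
      by (subst sum.swap) (simp only: mult_ac)
    finally have 2: "(\<Sum>l\<le>U. ?A n l * deriv (\<psi> l) x) = \<dots>" .
    have "deriv (\<psi> n) x * x = - (\<Sum>l\<le>U. ?B l n * (x * \<psi> l x))"
      using deriv_band[of n U x] U by (simp add: sum_distrib_left sum_distrib_right mult_ac)
    also have "(\<Sum>l\<le>U. ?B l n * (x * \<psi> l x)) = (\<Sum>l\<le>U. ?B l n * (\<Sum>m\<le>W. ?A l m * \<psi> m x))"
      by (intro sum.cong refl arg_cong2[where f = "(*)"] mult_band) (auto simp: W_def)
    also have "\<dots> = (\<Sum>m\<le>W. (\<Sum>l\<le>U. ?B l n * ?A l m) * \<psi> m x)"
      unfolding sum_distrib_left sum_distrib_right
      by (subst sum.swap) (simp only: mult_ac)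
    finally have 3: "deriv (\<psi> n) x * x = - \<dots>" .
    have "(\<Sum>m\<le>W. of_bool (m = n) * \<psi> m x) = (\<Sum>m\<le>W. if m = n then \<psi> m x else 0)"
      by (intro sum.cong) auto
    hence 4: "\<psi> n x = (\<Sum>m\<le>W. of_bool (m = n) * \<psi> m x)"
      using U by (simp add: W_def)
    have "P - Q - R = 0" if "y + D = E" "E = - Q" "D = - P" "y = R" for P Q R y D E :: complex
      using that by (simp add: algebra_simps)
    from this[OF 1 2 3 4] show ?thesis
      by (simp only: left_diff_distrib sum_subtractf)
  qed
  from quasi_polys_independent[OF p r this[unfolded \<psi>_def], of m] show ?thesis
    by (simp add: W_def)
qed

end

section \<open>Truncated band identities applied to sequences\<close>

lemma sum_window:
  fixes h :: "nat \<Rightarrow> complex"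
  assumes "\<And>m. m \<le> U \<Longrightarrow> m < n \<or> n + k < m \<Longrightarrow> h m = 0" and "n + k \<le> U"
  shows "(\<Sum>i\<le>k. h (n + i)) = (\<Sum>m\<le>U. h m)"
proof -
  have "(\<Sum>m\<le>U. h m) = (\<Sum>m\<in>{n..n + k}. h m)"
    by (rule sum.mono_neutral_right) (use assms in auto)
  also have "\<dots> = (\<Sum>i\<le>k. h (n + i))"
    by (rule sum.reindex_bij_witness[where i = "\<lambda>i. n + i" and j = "\<lambda>m. m - n"]) auto
  finally show ?thesis ..
qed

text \<open>Associativity for a row identity p Q = q R + (unit vector at N) applied to
  \<open>f\<close>. The relation R f = z f is requested only on the support of \<open>q\<close>;
  this keeps the truncated equations near index 0 out of the argument.\<close>

lemma string_apply:
  fixes f :: "nat \<Rightarrow> complex"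
  assumes "\<And>l. l \<le> U \<Longrightarrow> (\<Sum>m\<le>U. p m * Q m l) = (\<Sum>m\<le>U. q m * R m l) + of_bool (l = N)"
    and "N \<le> U" and "\<And>m. m \<le> U \<Longrightarrow> q m \<noteq> 0 \<Longrightarrow> (\<Sum>l\<le>U. R m l * f l) = z * f m"
  shows "(\<Sum>m\<le>U. p m * (\<Sum>l\<le>U. Q m l * f l)) = z * (\<Sum>m\<le>U. q m * f m) + f N"
proof -
  have "(\<Sum>m\<le>U. p m * (\<Sum>l\<le>U. Q m l * f l)) = (\<Sum>l\<le>U. (\<Sum>m\<le>U. p m * Q m l) * f l)"
    unfolding sum_distrib_left sum_distrib_right by (subst sum.swap) (simp only: mult_ac)
  also have "\<dots> = (\<Sum>l\<le>U. (\<Sum>m\<le>U. q m * R m l) * f l + (if l = N then f l else 0))"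
    using assms(1) by (intro sum.cong refl) (simp add: algebra_simps)
  also have "\<dots> = (\<Sum>m\<le>U. q m * (\<Sum>l\<le>U. R m l * f l)) + f N"
    unfolding sum.distrib sum_distrib_left sum_distrib_right
    using assms(2) by (subst sum.swap) (simp add: mult_ac)
  also have "(\<Sum>m\<le>U. q m * (\<Sum>l\<le>U. R m l * f l)) = z * (\<Sum>m\<le>U. q m * f m)"
    unfolding sum_distrib_left[of z]
  proof (intro sum.cong refl)
    fix m assume "m \<in> {..U}"
    thus "q m * (\<Sum>l\<le>U. R m l * f l) = z * (q m * f m)"
      using assms(3)[of m] by (cases "q m = 0") auto
  qed
  finally show ?thesis .
qed

lemma sum_from_minus_one:
  fixes h :: "int \<Rightarrow> complex"
  shows "(\<Sum>j\<in>{- 1..int e}. h j) = h (- 1) + h 0 + (\<Sum>j = 1..e. h (int j))"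
proof -
  have "{- 1..int e} = insert (- 1) (insert 0 (int ` {1..e}))"
  proof (intro equalityI subsetI)
    fix x assume x: "x \<in> {- 1..int e}"
    have "x \<in> int ` {1..e}" if "1 \<le> x"
      using x that by (intro image_eqI[of _ _ "nat x"]) auto
    thus "x \<in> insert (- 1) (insert 0 (int ` {1..e}))" using x by force
  qed auto
  thus ?thesis by (simp add: sum.reindex image_iff)
qed

text \<open>\<open>string\<close> is the identity B^T A - A B^T = 1 and \<open>string'\<close> is
  its transpose A^T B - B A^T = 1. In each, the bound on \<open>U\<close> covers the column with
  index n that is summed over.\<close>

locale string_pair =
  fixes d e :: nat and c b :: "int \<Rightarrow> int \<Rightarrow> complex"
  assumes d: "1 \<le> d" and gamma: "\<And>n. c (- 1) (int n) \<noteq> 0"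
    and top: "\<And>n. c (int d) (int (n + d)) \<noteq> 0"
    and string: "\<And>n m U. n + e + 1 \<le> U \<Longrightarrow>
      (\<Sum>l\<le>U. band e b l n * band d c l m) - (\<Sum>l\<le>U. band d c n l * band e b m l) = of_bool (m = n)"
    and string': "\<And>n m U. n + d + 1 \<le> U \<Longrightarrow>
      (\<Sum>l\<le>U. band d c l n * band e b l m) - (\<Sum>l\<le>U. band e b n l * band d c m l) = of_bool (m = n)"
begin

abbreviation A where "A \<equiv> band d c"
abbreviation B where "B \<equiv> band e b"

lemma A_row_window:
  assumes "n + d + 1 \<le> U"
  shows "(\<Sum>k\<le>Suc d. A (n + d) (n + k) * g (n + k)) = (\<Sum>m\<le>U. A (n + d) m * g m)"
  by (rule sum_window[where h = "\<lambda>m. A (n + d) m * g m"]) (use assms in \<open>auto simp: band_def\<close>)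

lemma A_column_window:
  assumes "n + d + 1 \<le> U"
  shows "(\<Sum>k\<le>Suc d. A (n + k) (Suc n) * g (n + k)) = (\<Sum>m\<le>U. A m (Suc n) * g m)"
  by (rule sum_window[where h = "\<lambda>m. A m (Suc n) * g m"]) (use assms in \<open>auto simp: band_def\<close>)

lemma B_row_truncate: "n + 1 \<le> U \<Longrightarrow> (\<Sum>l\<le>n + 1. B n l * g l) = (\<Sum>l\<le>U. B n l * g l)"
  by (rule sum.mono_neutral_left) (auto simp: band_def)

lemma B_column_truncate: "n + e \<le> U \<Longrightarrow> (\<Sum>l\<le>n + e. - B l n * g l) = (\<Sum>l\<le>U. - B l n * g l)"
  by (rule sum.mono_neutral_left) (auto simp: band_def)

text \<open>The extreme entries of row n + d are \<open>c d (n + d)\<close> on the left and gamma(n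
  + d) on the right. In \<open>column_recurrence\<close> gamma is the first coefficient and the
  \<open>c d\<close> entry the last.\<close>

lemma row_recurrence: "two_sided_recurrence (\<lambda>n k. A (n + d) (n + k)) d d"
  using d gamma[of "n + d" for n] top by unfold_locales (auto simp: band_def)

lemma column_recurrence: "two_sided_recurrence (\<lambda>n k. A (n + k) (Suc n)) d 1"
  using d gamma top[of "Suc n" for n] by unfold_locales (auto simp: band_def algebra_simps)

lemma row_solution:
  assumes "solves_recurrence (\<lambda>n k. A (n + d) (n + k)) d d z f" and "d \<le> n" and "n + 1 \<le> U"
  shows "(\<Sum>m\<le>U. A n m * f m) = z * f n"
  using A_row_window[of "n - d" U f] assms by (auto simp: solves_recurrence_def dest: spec[of _ "n - d"])

lemma column_solution:
  assumes "solves_recurrence (\<lambda>n k. A (n + k) (Suc n)) d 1 z g" and "1 \<le> n" and "n + d \<le> U"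
  shows "(\<Sum>m\<le>U. A m n * g m) = z * g n"
  using A_column_window[of "n - 1" U g] assms by (auto simp: solves_recurrence_def dest: spec[of _ "n - 1"])

text \<open>Column n + d of \<open>B\<close> starts at row n + d - 1, and A f = z f is available
  from row d on; hence \<open>1 \<le> n\<close>.\<close>

lemma row_compatible:
  assumes f: "solves_recurrence (\<lambda>n k. A (n + d) (n + k)) d d z f" and n: "1 \<le> n"
  defines "L \<equiv> \<lambda>f n. \<Sum>l\<le>n + e. - B l n * f l"
  shows "(\<Sum>k\<le>Suc d. A (n + d) (n + k) * L f (n + k)) = z * L f (n + d) + f (n + d)"
proof -
  define U where "U = n + d + e + 1"
  have "(\<Sum>k\<le>Suc d. A (n + d) (n + k) * L f (n + k)) = (\<Sum>m\<le>U. A (n + d) m * L f m)"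
    by (rule A_row_window) (simp add: U_def)
  also have "\<dots> = (\<Sum>m\<le>U. A (n + d) m * (\<Sum>l\<le>U. - B l m * f l))"
  proof (intro sum.cong refl)
    fix m
    show "A (n + d) m * L f m = A (n + d) m * (\<Sum>l\<le>U. - B l m * f l)"
    proof (cases "m \<le> n + d + 1")
      case True
      thus ?thesis unfolding L_def by (subst B_column_truncate[of m U]) (auto simp: U_def)
    qed (simp add: band_def)
  qed
  also have "\<dots> = z * (\<Sum>m\<le>U. - B m (n + d) * f m) + f (n + d)"
  proof (rule string_apply)
    fix l
    show "(\<Sum>m\<le>U. A (n + d) m * - B l m) = (\<Sum>m\<le>U. - B m (n + d) * A m l) + of_bool (l = n + d)"
      using string[of "n + d" U l] by (simp add: U_def sum_negf algebra_simps)
  next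
    fix m assume m: "m \<le> U" "- B m (n + d) \<noteq> 0"
    hence "n + d \<le> m + 1" "m \<le> n + d + e" by (auto simp: band_def split: if_splits)
    thus "(\<Sum>l\<le>U. A m l * f l) = z * f m"
      by (intro row_solution f) (use n in \<open>auto simp: U_def\<close>)
  qed (simp add: U_def)
  also have "(\<Sum>m\<le>U. - B m (n + d) * f m) = L f (n + d)"
    unfolding L_def by (rule B_column_truncate[symmetric]) (simp add: U_def)
  finally show ?thesis .
qed

text \<open>Row n + 1 of \<open>B\<close> reaches down to column n + 1 - e, and the transposed
  equation is available from column 1 on; hence \<open>e \<le> n\<close>.\<close>

lemma column_compatible:
  assumes g: "solves_recurrence (\<lambda>n k. A (n + k) (Suc n)) d 1 z g" and n: "e \<le> n"
  defines "L \<equiv> \<lambda>g n. \<Sum>l\<le>n + 1. B n l * g l"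
  shows "(\<Sum>k\<le>Suc d. A (n + k) (Suc n) * L g (n + k)) = z * L g (n + 1) + g (n + 1)"
proof -
  define U where "U = Suc n + d + 1"
  have "(\<Sum>k\<le>Suc d. A (n + k) (Suc n) * L g (n + k)) = (\<Sum>m\<le>U. A m (Suc n) * L g m)"
    by (rule A_column_window) (simp add: U_def)
  also have "\<dots> = (\<Sum>m\<le>U. A m (Suc n) * (\<Sum>l\<le>U. B m l * g l))"
  proof (intro sum.cong refl)
    fix m
    show "A m (Suc n) * L g m = A m (Suc n) * (\<Sum>l\<le>U. B m l * g l)"
    proof (cases "m \<le> Suc n + d")
      case True
      thus ?thesis unfolding L_def by (subst B_row_truncate[of m U]) (auto simp: U_def)
    qed (simp add: band_def)
  qed
  also have "\<dots> = z * (\<Sum>m\<le>U. B (Suc n) m * g m) + g (Suc n)"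
  proof (rule string_apply)
    fix l
    show "(\<Sum>m\<le>U. A m (Suc n) * B m l) = (\<Sum>m\<le>U. B (Suc n) m * A l m) + of_bool (l = Suc n)"
      using string'[of "Suc n" U l] by (simp add: U_def algebra_simps)
  next
    fix m assume m: "m \<le> U" "B (Suc n) m \<noteq> 0"
    hence "Suc n \<le> m + e" "m \<le> Suc n + 1" by (auto simp: band_def split: if_splits)
    thus "(\<Sum>l\<le>U. A l m * g l) = z * g m"
      by (intro column_solution g) (use n in \<open>auto simp: U_def\<close>)
  qed (simp add: U_def)
  also have "(\<Sum>m\<le>U. B (Suc n) m * g m) = L g (n + 1)"
    unfolding L_def using B_row_truncate[of "Suc n" U g] by (simp add: U_def)
  finally show ?thesis by simp
qed

end

section \<open>Ladder matrices acting on windows\<close>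

lemma mult_mat_entry:
  assumes "A \<in> carrier_mat n n" and "B \<in> carrier_mat n n" and "i < n" and "k < n"
  shows "(A * B) $$ (i, k) = (\<Sum>l<n. A $$ (i, l) * B $$ (l, k))"
  using assms by (simp add: scalar_prod_def lessThan_atLeast0)

lemma invertible_mat_iff_det:
  fixes A :: "complex mat"
  assumes "A \<in> carrier_mat n n"
  shows "invertible_mat A \<longleftrightarrow> Determinant.det A \<noteq> 0"
proof
  assume "invertible_mat A"
  then obtain B where B: "A * B = 1\<^sub>m n" "B * A = 1\<^sub>m (dim_row B)"
    using assms by (auto simp: invertible_mat_def inverts_mat_def)
  have "dim_col B = n" using B(1) by (metis index_mult_mat(3) index_one_mat(3))
  moreover have "dim_row B = n" using B(2) assms by (metis carrier_matD(2) index_mult_mat(3) index_one_mat(3))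
  ultimately have "B \<in> carrier_mat n n" by auto
  hence "Determinant.det A * Determinant.det B = 1"
    using det_mult[OF assms] B(1) by (metis det_one)
  thus "Determinant.det A \<noteq> 0" by auto
next
  assume "Determinant.det A \<noteq> 0"
  from det_non_zero_imp_unit[OF assms this] obtain B where
    "B \<in> carrier_mat n n" "A * B = 1\<^sub>m n" "B * A = 1\<^sub>m n"
    by (auto simp: Units_def ring_mat_def)
  thus "invertible_mat A" using assms
    by (auto simp: invertible_mat_def inverts_mat_def)
qed

lemma mat_inv_props:
  assumes "A \<in> carrier_mat n n" and "Determinant.det A \<noteq> 0"
  shows "mat_inv A \<in> carrier_mat n n" and "mat_inv A * A = 1\<^sub>m n" and "A * mat_inv A = 1\<^sub>m n"
proof -
  have "mat_inverse A \<noteq> None"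
    using mat_inverse(1)[OF assms(1), where b = "()"] det_non_zero_imp_unit[OF assms, where b = "()"]
    by blast
  then obtain B where "mat_inverse A = Some B" by auto
  thus "mat_inv A \<in> carrier_mat n n" "mat_inv A * A = 1\<^sub>m n" "A * mat_inv A = 1\<^sub>m n"
    using mat_inverse(2)[OF assms(1)] by (auto simp: mat_inv_def)
qed

text \<open>Columns are solutions, rows are consecutive indices starting at n. The matrix solution
  at N is the window at n = N - d, so that its last row has index N; the barred one at N - 1 is the
  transposed window at n = N - 1.\<close>

definition window_mat :: "nat \<Rightarrow> (nat \<Rightarrow> nat \<Rightarrow> complex \<Rightarrow> complex) \<Rightarrow> nat \<Rightarrow> complex \<Rightarrow> complex mat" where
  "window_mat d f n z = Matrix.mat (Suc d) (Suc d) (\<lambda>(i, k). f k (n + i) z)"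

lemma window_mat_carrier [simp]: "window_mat d f n z \<in> carrier_mat (Suc d) (Suc d)"
  by (simp add: window_mat_def)

lemma window_mat_entry: "i \<le> d \<Longrightarrow> k \<le> d \<Longrightarrow> window_mat d f n z $$ (i, k) = f k (n + i) z"
  by (simp add: window_mat_def)

lemma window_mat_det:
  assumes "\<And>c. \<forall>i\<le>d. (\<Sum>k\<le>d. c k * f k (n + i) z) = 0 \<Longrightarrow> \<forall>k\<le>d. c k = 0"
  shows "Determinant.det (window_mat d f n z) \<noteq> 0"
proof
  let ?W = "window_mat d f n z"
  assume "Determinant.det ?W = 0"
  then obtain v where v: "v \<in> carrier_vec (Suc d)" "v \<noteq> 0\<^sub>v (Suc d)" "?W *\<^sub>v v = 0\<^sub>v (Suc d)"
    using det_0_iff_vec_prod_zero[OF window_mat_carrier[of d f n z]] by blast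
  have "(\<Sum>k\<le>d. vec_index v k * f k (n + i) z) = 0" if "i \<le> d" for i
  proof -
    have "(\<Sum>k\<le>d. vec_index v k * f k (n + i) z) = vec_index (?W *\<^sub>v v) i"
      using that v(1)
      by (auto simp: window_mat_def scalar_prod_def atLeast0LessThan lessThan_Suc_atMost mult.commute
          intro!: sum.cong)
    thus ?thesis using v(3) that by simp
  qed
  hence "\<forall>k\<le>d. vec_index v k = 0" using assms[of "vec_index v"] by blast
  hence "v = 0\<^sub>v (Suc d)" using v(1) by (intro eq_vecI) auto
  thus False using v(2) by contradiction
qed

lemma ladder_carrier [simp]: "ladder d c N z \<in> carrier_mat (Suc d) (Suc d)"
  by (simp add: ladder_def)

lemma ladder_bar_carrier [simp]: "ladder_bar d c N z \<in> carrier_mat (Suc d) (Suc d)"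
  by (simp add: ladder_bar_def)

lemma diag_from_carrier [simp]: "diag_from d g M \<in> carrier_mat (Suc d) (Suc d)"
  by (simp add: diag_from_def)

lemma mat_sum_carrier [simp]: "mat_sum n F J \<in> carrier_mat n n"
  by (simp add: mat_sum_def)

lemma prod_up_carrier:
  "(\<And>M. F M \<in> carrier_mat n n) \<Longrightarrow> prod_up n F N j \<in> carrier_mat n n"
  by (induction j) (simp_all add: mult_carrier_mat[of _ n n])

lemma prod_down_carrier:
  "(\<And>M. F M \<in> carrier_mat n n) \<Longrightarrow> prod_down n F N j \<in> carrier_mat n n"
  by (induction j) (simp_all add: mult_carrier_mat[of _ n n])

lemma diag_from_mult_left:
  assumes X: "X \<in> carrier_mat (Suc d) (Suc d)" and "i \<le> d" and "k \<le> d"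
  shows "(diag_from d g M * X) $$ (i, k) = g (M + int i) * X $$ (i, k)"
proof -
  have "(diag_from d g M * X) $$ (i, k) = (\<Sum>l<Suc d. diag_from d g M $$ (i, l) * X $$ (l, k))"
    by (rule mult_mat_entry) (use assms in auto)
  also have "\<dots> = (\<Sum>l<Suc d. if l = i then g (M + int i) * X $$ (i, k) else 0)"
    using assms by (intro sum.cong refl) (auto simp: diag_from_def)
  finally show ?thesis using assms by simp
qed

lemma diag_from_mult_right:
  assumes X: "X \<in> carrier_mat (Suc d) (Suc d)" and "i \<le> d" and "k \<le> d"
  shows "(X * diag_from d g M) $$ (k, i) = X $$ (k, i) * g (M + int i)"
proof -
  have "(X * diag_from d g M) $$ (k, i) = (\<Sum>l<Suc d. X $$ (k, l) * diag_from d g M $$ (l, i))"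
    by (rule mult_mat_entry) (use assms in auto)
  also have "\<dots> = (\<Sum>l<Suc d. if l = i then X $$ (k, i) * g (M + int i) else 0)"
    using assms by (intro sum.cong refl) (auto simp: diag_from_def)
  finally show ?thesis using assms by simp
qed

lemma mat_sum_mult_left:
  assumes X: "X \<in> carrier_mat n n" and F: "\<And>j. j \<in> J \<Longrightarrow> F j \<in> carrier_mat n n"
    and "i < n" and "k < n"
  shows "(mat_sum n F J * X) $$ (i, k) = (\<Sum>j\<in>J. (F j * X) $$ (i, k))"
proof -
  have "(mat_sum n F J * X) $$ (i, k) = (\<Sum>l<n. (\<Sum>j\<in>J. F j $$ (i, l)) * X $$ (l, k))"
    using assms by (subst mult_mat_entry[of _ n]) (auto simp: mat_sum_def)
  also have "\<dots> = (\<Sum>j\<in>J. \<Sum>l<n. F j $$ (i, l) * X $$ (l, k))"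
    unfolding sum_distrib_right by (rule sum.swap)
  also have "\<dots> = (\<Sum>j\<in>J. (F j * X) $$ (i, k))"
    by (intro sum.cong refl mult_mat_entry[symmetric] assms)
  finally show ?thesis .
qed

lemma mat_sum_mult_right:
  assumes X: "X \<in> carrier_mat n n" and F: "\<And>j. j \<in> J \<Longrightarrow> F j \<in> carrier_mat n n"
    and "i < n" and "k < n"
  shows "(X * mat_sum n F J) $$ (k, i) = (\<Sum>j\<in>J. (X * F j) $$ (k, i))"
proof -
  have "(X * mat_sum n F J) $$ (k, i) = (\<Sum>l<n. X $$ (k, l) * (\<Sum>j\<in>J. F j $$ (l, i)))"
    using assms by (subst mult_mat_entry[of _ n]) (auto simp: mat_sum_def)
  also have "\<dots> = (\<Sum>j\<in>J. \<Sum>l<n. X $$ (k, l) * F j $$ (l, i))"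
    unfolding sum_distrib_left by (rule sum.swap)
  also have "\<dots> = (\<Sum>j\<in>J. (X * F j) $$ (k, i))"
    by (intro sum.cong refl mult_mat_entry[symmetric] assms)
  finally show ?thesis .
qed

context string_pair
begin

text \<open>The ladder matrix is a companion matrix: its last row is the recurrence for row n + d of
  \<open>A\<close>, solved for the entry at n + d + 1.\<close>

lemma ladder_window:
  assumes f: "\<And>k. solves_recurrence (\<lambda>n k. A (n + d) (n + k)) d d z (\<lambda>n. f k n z)"
  shows "ladder d c (int (n + d)) z * window_mat d f n z = window_mat d f (Suc n) z" (is "?L * ?W = ?W'")
proof (rule eq_matI)
  fix i k assume ik: "i < dim_row ?W'" "k < dim_col ?W'"
  hence ik: "i \<le> d" "k \<le> d" by (simp_all add: window_mat_def)
  have "(?L * ?W) $$ (i, k) = (\<Sum>l<Suc d. ?L $$ (i, l) * ?W $$ (l, k))"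
    by (rule mult_mat_entry) (use ik in auto)
  also have "\<dots> = (\<Sum>l\<le>d. ?L $$ (i, l) * f k (n + l) z)"
    by (intro sum.cong) (use ik in \<open>auto simp: window_mat_entry\<close>)
  also have "\<dots> = f k (Suc n + i) z"
  proof (cases "i < d")
    case True
    hence "(\<Sum>l\<le>d. ?L $$ (i, l) * f k (n + l) z) = (\<Sum>l\<le>d. if l = i + 1 then f k (n + (i + 1)) z else 0)"
      by (intro sum.cong refl) (auto simp: ladder_def)
    thus ?thesis using True by simp
  next
    case False
    hence i: "i = d" using ik by simp
    let ?\<gamma> = "c (- 1) (int (n + d))"
    have "?\<gamma> * (\<Sum>l\<le>d. ?L $$ (d, l) * f k (n + l) z)
        = (\<Sum>l\<le>d. (if l = d then z * f k (n + d) z else 0) - A (n + d) (n + l) * f k (n + l) z)"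
      unfolding sum_distrib_left
    proof (intro sum.cong refl)
      fix l assume "l \<in> {..d}"
      thus "?\<gamma> * (?L $$ (d, l) * f k (n + l) z)
          = (if l = d then z * f k (n + d) z else 0) - A (n + d) (n + l) * f k (n + l) z"
        using gamma[of "n + d"]
        by (cases "l = d") (auto simp: ladder_def band_def of_nat_diff field_simps)
    qed
    also have "\<dots> = z * f k (n + d) z - (\<Sum>l\<le>d. A (n + d) (n + l) * f k (n + l) z)"
      by (simp add: sum_subtractf)
    also have "\<dots> = ?\<gamma> * f k (Suc n + d) z"
      using f[of k] by (auto simp: solves_recurrence_def band_def algebra_simps dest!: spec[of _ n])
    finally show ?thesis using gamma[of "n + d"] i by simp
  qed
  finally show "(?L * ?W) $$ (i, k) = ?W' $$ (i, k)" using ik by (simp add: window_mat_entry)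
next
  show "dim_row (?L * ?W) = dim_row ?W'" by (simp add: ladder_def window_mat_def)
  show "dim_col (?L * ?W) = dim_col ?W'" by (simp add: window_mat_def)
qed

text \<open>The first column is the recurrence for column n + 1 of \<open>A\<close> solved for g n,
  which moves the window down; the divisor gamma(N - 1) is the entry of \<open>A\<close> at (n, n +
  1).\<close>

lemma window_ladder_bar:
  assumes g: "\<And>k. solves_recurrence (\<lambda>n k. A (n + k) (Suc n)) d 1 z (\<lambda>n. g k n z)"
  shows "transpose_mat (window_mat d g (Suc n) z) * ladder_bar d c (int n + 1) z
    = transpose_mat (window_mat d g n z)" (is "?W' * ?L = ?W")
proof (rule eq_matI)
  fix k i assume ik: "k < dim_row ?W" "i < dim_col ?W"
  hence ik: "i \<le> d" "k \<le> d" by (simp_all add: window_mat_def)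
  have "(?W' * ?L) $$ (k, i) = (\<Sum>l<Suc d. ?W' $$ (k, l) * ?L $$ (l, i))"
    by (rule mult_mat_entry) (use ik in auto)
  also have "\<dots> = (\<Sum>l\<le>d. g k (Suc n + l) z * ?L $$ (l, i))"
    by (intro sum.cong) (use ik in \<open>auto simp: window_mat_def\<close>)
  also have "\<dots> = g k (n + i) z"
  proof (cases "i = 0")
    case False
    hence "(\<Sum>l\<le>d. g k (Suc n + l) z * ?L $$ (l, i)) = (\<Sum>l\<le>d. if l = i - 1 then g k (n + i) z else 0)"
      using ik by (intro sum.cong refl) (auto simp: ladder_bar_def)
    thus ?thesis using ik by simp
  next
    case True
    let ?\<gamma> = "c (- 1) (int n)"
    have "?\<gamma> * (\<Sum>l\<le>d. g k (Suc n + l) z * ?L $$ (l, 0))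
        = (\<Sum>l\<le>d. (if l = 0 then z * g k (n + 1) z else 0) - A (n + Suc l) (Suc n) * g k (n + Suc l) z)"
      unfolding sum_distrib_left
    proof (intro sum.cong refl)
      fix l assume "l \<in> {..d}"
      thus "?\<gamma> * (g k (Suc n + l) z * ?L $$ (l, 0))
          = (if l = 0 then z * g k (n + 1) z else 0) - A (n + Suc l) (Suc n) * g k (n + Suc l) z"
        using gamma[of n]
        by (cases "l = 0") (auto simp: ladder_bar_def band_def field_simps)
    qed
    also have "\<dots> = z * g k (n + 1) z - (\<Sum>l\<le>d. A (n + Suc l) (Suc n) * g k (n + Suc l) z)"
      by (simp add: sum_subtractf)
    also have "\<dots> = ?\<gamma> * g k n z"
    proof -
      have "(\<Sum>l\<le>Suc d. A (n + l) (Suc n) * g k (n + l) z) = z * g k (n + 1) z"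
        using g[of k] by (simp only: solves_recurrence_def)
      hence "A n (Suc n) * g k n z + (\<Sum>l\<le>d. A (n + Suc l) (Suc n) * g k (n + Suc l) z) = z * g k (n + 1) z"
        unfolding sum.atMost_Suc_shift by simp
      moreover have "A n (Suc n) = ?\<gamma>" by (simp add: band_def)
      ultimately show ?thesis by (simp add: algebra_simps)
    qed
    finally show ?thesis using gamma[of n] True by simp
  qed
  finally show "(?W' * ?L) $$ (k, i) = ?W $$ (k, i)" using ik by (simp add: window_mat_def)
next
  show "dim_row (?W' * ?L) = dim_row ?W" by (simp add: window_mat_def)
  show "dim_col (?W' * ?L) = dim_col ?W" by (simp add: ladder_bar_def window_mat_def)
qed

end

section \<open>Differential matrices acting on windows\<close>

lemma invertible_window_mat:
  assumes "Determinant.det (window_mat d f n z) \<noteq> 0"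
  shows "invertible_mat (window_mat d f n z)" and "invertible_mat (transpose_mat (window_mat d f n z))"
  using assms
  by (simp_all add: invertible_mat_iff_det[where n = "Suc d"] det_transpose[where n = "Suc d"])

lemma factor_det_nonzero:
  fixes X Y :: "complex mat"
  assumes "X \<in> carrier_mat n n" and "Y \<in> carrier_mat n n" and "Determinant.det (X * Y) \<noteq> 0"
  shows "Determinant.det X \<noteq> 0" and "Determinant.det Y \<noteq> 0"
  using assms by (auto simp: det_mult)

context string_pair
begin

lemma prod_up_window:
  assumes f: "\<And>k. solves_recurrence (\<lambda>n k. A (n + d) (n + k)) d d z (\<lambda>n. f k n z)"
  shows "prod_up (Suc d) (\<lambda>M. ladder d c M z) (int (n + d)) j * window_mat d f n z = window_mat d f (n + j) z"
proof (induction j)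
  case 0
  show ?case by (simp add: left_mult_one_mat[OF window_mat_carrier])
next
  case (Suc j)
  let ?P = "prod_up (Suc d) (\<lambda>M. ladder d c M z) (int (n + d)) j"
  have "ladder d c (int (n + d) + int j) z * ?P * window_mat d f n z
      = ladder d c (int (n + d) + int j) z * (?P * window_mat d f n z)"
    by (rule assoc_mult_mat[OF ladder_carrier prod_up_carrier window_mat_carrier]) simp
  also have "\<dots> = window_mat d f (Suc (n + j)) z"
    using ladder_window[where f = f and n = "n + j", OF f] Suc by (simp add: add_ac)
  finally show ?case by simp
qed

lemma window_prod_down:
  assumes g: "\<And>k. solves_recurrence (\<lambda>n k. A (n + k) (Suc n)) d 1 z (\<lambda>n. g k n z)"
    and "j \<le> n"
  shows "transpose_mat (window_mat d g n z) * prod_down (Suc d) (\<lambda>M. ladder_bar d c M z) (int n + 1) j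
    = transpose_mat (window_mat d g (n - j) z)"
  using assms(2)
proof (induction j)
  case 0
  show ?case by (simp add: right_mult_one_mat[of _ "Suc d" "Suc d"])
next
  case (Suc j)
  let ?P = "prod_down (Suc d) (\<lambda>M. ladder_bar d c M z) (int n + 1) j"
  let ?W = "\<lambda>n. transpose_mat (window_mat d g n z)"
  have idx: "int n + 1 - 1 - int j = int (n - Suc j) + 1" using Suc.prems by simp
  have "?W n * (?P * ladder_bar d c (int n + 1 - 1 - int j) z)
      = ?W n * ?P * ladder_bar d c (int n + 1 - 1 - int j) z"
    by (rule assoc_mult_mat[symmetric, of _ "Suc d" "Suc d" _ "Suc d" _ "Suc d"])
      (simp_all add: prod_down_carrier)
  also have "\<dots> = ?W (Suc (n - Suc j)) * ladder_bar d c (int (n - Suc j) + 1) z"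
    unfolding idx using Suc by (simp add: Suc_diff_Suc)
  also have "\<dots> = ?W (n - Suc j)" by (rule window_ladder_bar[where g = g, OF g])
  finally show ?case by simp
qed

text \<open>Every ladder product merely shifts the window, and the diagonal factor supplies the
  weights b_j(n + i + j). The sum is therefore the action of B^T. The inverse ladder shifts down by
  one, which requires \<open>1 \<le> n\<close>.\<close>

lemma diff_matrix_window:
  assumes f: "\<And>k. solves_recurrence (\<lambda>n k. A (n + d) (n + k)) d d z (\<lambda>n. f k n z)"
    and det: "\<And>n. Determinant.det (window_mat d f n z) \<noteq> 0"
    and n: "1 \<le> n" and ik: "i \<le> d" "k \<le> d"
  shows "diff_matrix d c e b (int (n + d)) z \<in> carrier_mat (Suc d) (Suc d)"
    and "(diff_matrix d c e b (int (n + d)) z * window_mat d f n z) $$ (i, k)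
      = (\<Sum>l\<le>n + i + e. B l (n + i) * f k l z)"
proof -
  let ?W = "\<lambda>n. window_mat d f n z"
  let ?L = "ladder d c (int (n + d) - 1) z"
  let ?D1 = "diag_from d (b (- 1)) (int (n + d) - 1 - int d)"
  let ?D2 = "diag_from d (b 0) (int (n + d) - int d)"
  let ?P = "prod_up (Suc d) (\<lambda>M. ladder d c M z) (int (n + d))"
  let ?F = "\<lambda>j. diag_from d (b (int j)) (int (n + d) + int j - int d) * ?P j"
  have W: "?W m \<in> carrier_mat (Suc d) (Suc d)" for m by simp
  have P: "?P j \<in> carrier_mat (Suc d) (Suc d)" for j by (rule prod_up_carrier) simp
  have F: "?F j \<in> carrier_mat (Suc d) (Suc d)" for j by (rule mult_carrier_mat[OF diag_from_carrier P])
  have "int (n + d) - 1 = int (n - 1 + d)" "Suc (n - 1) = n" using n by auto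
  hence LW: "?L * ?W (n - 1) = ?W n"
    using ladder_window[where f = f and n = "n - 1", OF f] by simp
  \<comment> \<open>The ladder matrix carries one nonsingular window to another, so its
    invertibility needs no determinant expansion.\<close>
  have "Determinant.det ?L \<noteq> 0"
    by (rule factor_det_nonzero(1)[OF ladder_carrier W[of "n - 1"]]) (unfold LW, rule det)
  note inv = mat_inv_props[OF ladder_carrier this]
  have inv_W: "mat_inv ?L * ?W n = ?W (n - 1)"
    unfolding LW[symmetric] assoc_mult_mat[OF inv(1) ladder_carrier W, symmetric] inv(2)
    by (rule left_mult_one_mat[OF W])
  have D1: "?D1 * mat_inv ?L \<in> carrier_mat (Suc d) (Suc d)"
    by (rule mult_carrier_mat[OF diag_from_carrier inv(1)])
  have D12: "?D1 * mat_inv ?L + ?D2 \<in> carrier_mat (Suc d) (Suc d)"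
    by (rule add_carrier_mat) simp
  have D: "diff_matrix d c e b (int (n + d)) z = ?D1 * mat_inv ?L + ?D2 + mat_sum (Suc d) ?F {1..e}"
    by (simp add: diff_matrix_def)
  show "diff_matrix d c e b (int (n + d)) z \<in> carrier_mat (Suc d) (Suc d)"
    unfolding D by (rule add_carrier_mat) simp
  have "diff_matrix d c e b (int (n + d)) z * ?W n
      = ?D1 * ?W (n - 1) + ?D2 * ?W n + mat_sum (Suc d) ?F {1..e} * ?W n"
    unfolding D add_mult_distrib_mat[OF D12 mat_sum_carrier W] add_mult_distrib_mat[OF D1 diag_from_carrier W]
      assoc_mult_mat[OF diag_from_carrier inv(1) W] inv_W ..
  hence "(diff_matrix d c e b (int (n + d)) z * ?W n) $$ (i, k)
      = (?D1 * ?W (n - 1)) $$ (i, k) + (?D2 * ?W n) $$ (i, k)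
        + (mat_sum (Suc d) ?F {1..e} * ?W n) $$ (i, k)"
    using ik by (simp add: diag_from_def window_mat_def mat_sum_def)
  also have "(?D1 * ?W (n - 1)) $$ (i, k) = b (- 1) (int (n + i) - 1) * f k (nat (int (n + i) - 1)) z"
  proof -
    have "nat (int (n + i) - 1) = n - 1 + i" using n by linarith
    moreover have "int (n + d) - 1 - int d + int i = int (n + i) - 1" by simp
    ultimately show ?thesis
      using ik by (simp only: diag_from_mult_left[OF W ik] window_mat_entry)
  qed
  also have "(?D2 * ?W n) $$ (i, k) = b 0 (int (n + i)) * f k (n + i) z"
    using ik by (subst diag_from_mult_left[OF W ik]) (simp add: window_mat_entry)
  also have "(mat_sum (Suc d) ?F {1..e} * ?W n) $$ (i, k)
      = (\<Sum>j = 1..e. b (int j) (int (n + i) + int j) * f k (nat (int (n + i) + int j)) z)"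
  proof -
    have "(mat_sum (Suc d) ?F {1..e} * ?W n) $$ (i, k) = (\<Sum>j = 1..e. (?F j * ?W n) $$ (i, k))"
      by (rule mat_sum_mult_left[OF W F]) (use ik in auto)
    also have "\<dots> = (\<Sum>j = 1..e. b (int j) (int (n + i) + int j) * f k (nat (int (n + i) + int j)) z)"
    proof (intro sum.cong refl)
      fix j
      have "?F j * ?W n = diag_from d (b (int j)) (int (n + d) + int j - int d) * ?W (n + j)"
        unfolding assoc_mult_mat[OF diag_from_carrier P W] prod_up_window[where f = f, OF f] ..
      thus "(?F j * ?W n) $$ (i, k) = b (int j) (int (n + i) + int j) * f k (nat (int (n + i) + int j)) z"
        using ik by (simp add: diag_from_mult_left[OF W ik] window_mat_entry nat_add_distrib add_ac)
    qed
    finally show ?thesis .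
  qed
  also have "b (- 1) (int (n + i) - 1) * f k (nat (int (n + i) - 1)) z + b 0 (int (n + i)) * f k (n + i) z
        + (\<Sum>j = 1..e. b (int j) (int (n + i) + int j) * f k (nat (int (n + i) + int j)) z)
      = (\<Sum>j\<in>{- 1..int e}. b j (int (n + i) + j) * f k (nat (int (n + i) + j)) z)"
    unfolding sum_from_minus_one by (simp add: nat_int_add)
  \<comment> \<open>No index is negative once \<open>1 \<le> n\<close>, so the omission of such
    terms is vacuous here.\<close>
  also have "{- 1..int e} = {j \<in> {- 1..int e}. 0 \<le> int (n + i) + j}" using n by auto
  also have "(\<Sum>j\<in>\<dots>. b j (int (n + i) + j) * f k (nat (int (n + i) + j)) z)
      = (\<Sum>l\<le>n + i + e. B l (n + i) * f k l z)"
    by (rule sum_band_column) simp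
  finally show "(diff_matrix d c e b (int (n + d)) z * ?W n) $$ (i, k)
      = (\<Sum>l\<le>n + i + e. B l (n + i) * f k l z)" .
qed

text \<open>The dual computation gives the action of \<open>B\<close>. The factor with j lowers the
  window from n to n - j, and j runs up to e, hence \<open>e \<le> n\<close>.\<close>

lemma window_diff_matrix_bar:
  assumes g: "\<And>k. solves_recurrence (\<lambda>n k. A (n + k) (Suc n)) d 1 z (\<lambda>n. g k n z)"
    and det: "\<And>n. Determinant.det (window_mat d g n z) \<noteq> 0"
    and n: "e \<le> n" and ik: "i \<le> d" "k \<le> d"
  shows "diff_matrix_bar d c e b (int n + 1) z \<in> carrier_mat (Suc d) (Suc d)"
    and "(transpose_mat (window_mat d g n z) * diff_matrix_bar d c e b (int n + 1) z) $$ (k, i)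
      = (\<Sum>l\<le>n + i + 1. B (n + i) l * g k l z)"
proof -
  let ?W = "\<lambda>n. transpose_mat (window_mat d g n z)"
  let ?L = "ladder_bar d c (int n + 1) z"
  let ?D = "\<lambda>j. diag_from d (b j) (int n + 1 - 1)"
  let ?P = "prod_down (Suc d) (\<lambda>M. ladder_bar d c M z) (int n + 1)"
  let ?F = "\<lambda>j. ?P j * ?D (int j)"
  have W: "?W m \<in> carrier_mat (Suc d) (Suc d)" for m by simp
  have W_entry: "?W m $$ (k, i) = g k (m + i) z" for m using ik by (simp add: window_mat_def)
  have detW: "Determinant.det (?W m) \<noteq> 0" for m
    using det[of m] by (simp add: det_transpose[where n = "Suc d"])
  have P: "?P j \<in> carrier_mat (Suc d) (Suc d)" for j by (rule prod_down_carrier) simp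
  have F: "?F j \<in> carrier_mat (Suc d) (Suc d)" for j by (rule mult_carrier_mat[OF P diag_from_carrier])
  have WL: "?W (Suc n) * ?L = ?W n" by (rule window_ladder_bar[where g = g, OF g])
  have "Determinant.det ?L \<noteq> 0"
    by (rule factor_det_nonzero(2)[OF W[of "Suc n"] ladder_bar_carrier]) (unfold WL, rule detW)
  note inv = mat_inv_props[OF ladder_bar_carrier this]
  have inv_W: "?W n * mat_inv ?L = ?W (Suc n)"
    unfolding WL[symmetric] assoc_mult_mat[OF W ladder_bar_carrier inv(1)] inv(3)
    by (rule right_mult_one_mat[OF W])
  have D1: "mat_inv ?L * ?D (- 1) \<in> carrier_mat (Suc d) (Suc d)"
    by (rule mult_carrier_mat[OF inv(1) diag_from_carrier])
  have D12: "mat_inv ?L * ?D (- 1) + ?D 0 \<in> carrier_mat (Suc d) (Suc d)"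
    by (rule add_carrier_mat) simp
  have D: "diff_matrix_bar d c e b (int n + 1) z = mat_inv ?L * ?D (- 1) + ?D 0 + mat_sum (Suc d) ?F {1..e}"
    by (simp add: diff_matrix_bar_def)
  show "diff_matrix_bar d c e b (int n + 1) z \<in> carrier_mat (Suc d) (Suc d)"
    unfolding D by (rule add_carrier_mat) simp
  have "?W n * diff_matrix_bar d c e b (int n + 1) z
      = ?W (Suc n) * ?D (- 1) + ?W n * ?D 0 + ?W n * mat_sum (Suc d) ?F {1..e}"
    unfolding D mult_add_distrib_mat[OF W D12 mat_sum_carrier] mult_add_distrib_mat[OF W D1 diag_from_carrier]
      assoc_mult_mat[OF W inv(1) diag_from_carrier, symmetric] inv_W ..
  hence "(?W n * diff_matrix_bar d c e b (int n + 1) z) $$ (k, i)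
      = (?W (Suc n) * ?D (- 1)) $$ (k, i) + (?W n * ?D 0) $$ (k, i)
        + (?W n * mat_sum (Suc d) ?F {1..e}) $$ (k, i)"
    using ik by (simp add: diag_from_def window_mat_def mat_sum_def)
  also have "(?W (Suc n) * ?D (- 1)) $$ (k, i) = b (- 1) (int (n + i)) * g k (nat (int (n + i) - (- 1))) z"
    by (subst diag_from_mult_right[OF W ik]) (simp add: W_entry nat_add_distrib)
  also have "(?W n * ?D 0) $$ (k, i) = b 0 (int (n + i)) * g k (nat (int (n + i) - 0)) z"
    by (subst diag_from_mult_right[OF W ik]) (simp add: W_entry nat_add_distrib)
  also have "(?W n * mat_sum (Suc d) ?F {1..e}) $$ (k, i)
      = (\<Sum>j = 1..e. b (int j) (int (n + i)) * g k (nat (int (n + i) - int j)) z)"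
  proof -
    have "(?W n * mat_sum (Suc d) ?F {1..e}) $$ (k, i) = (\<Sum>j = 1..e. (?W n * ?F j) $$ (k, i))"
      by (rule mat_sum_mult_right[OF W F]) (use ik in auto)
    also have "\<dots> = (\<Sum>j = 1..e. b (int j) (int (n + i)) * g k (nat (int (n + i) - int j)) z)"
    proof (intro sum.cong refl)
      fix j assume "j \<in> {1..e}"
      hence j: "j \<le> n" using n by simp
      have "?W n * ?F j = ?W (n - j) * ?D (int j)"
        unfolding assoc_mult_mat[OF W P diag_from_carrier, symmetric] window_prod_down[where g = g, OF g j] ..
      moreover have "nat (int (n + i) - int j) = n - j + i" using j by simp
      ultimately show "(?W n * ?F j) $$ (k, i) = b (int j) (int (n + i)) * g k (nat (int (n + i) - int j)) z"
        by (simp add: diag_from_mult_right[OF W ik] W_entry)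
    qed
    finally show ?thesis .
  qed
  also have "b (- 1) (int (n + i)) * g k (nat (int (n + i) - (- 1))) z
        + b 0 (int (n + i)) * g k (nat (int (n + i) - 0)) z
        + (\<Sum>j = 1..e. b (int j) (int (n + i)) * g k (nat (int (n + i) - int j)) z)
      = (\<Sum>j\<in>{- 1..int e}. b j (int (n + i)) * g k (nat (int (n + i) - j)) z)"
    unfolding sum_from_minus_one ..
  also have "{- 1..int e} = {j \<in> {- 1..int e}. 0 \<le> int (n + i) - j}" using n by auto
  also have "(\<Sum>j\<in>\<dots>. b j (int (n + i)) * g k (nat (int (n + i) - j)) z)
      = (\<Sum>l\<le>n + i + 1. B (n + i) l * g k l z)"
    by (rule sum_band_row) simp
  finally show "(?W n * diff_matrix_bar d c e b (int n + 1) z) $$ (k, i)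
      = (\<Sum>l\<le>n + i + 1. B (n + i) l * g k l z)" .
qed

section \<open>Assembly of the matrix solutions\<close>

lemma ladder_system:
  "\<exists>\<Psi> :: int \<Rightarrow> complex \<Rightarrow> complex mat. \<forall>N \<ge> int d + 1.
     everywhere_invertible (d + 1) (\<Psi> N) \<and>
     (\<forall>x. \<Psi> (N + 1) x = ladder d c N x * \<Psi> N x) \<and>
     (\<forall>x. mat_has_derivative (\<Psi> N) (- diff_matrix d c e b N x * \<Psi> N x) x)"
proof -
  obtain f where f: "\<And>k z. solves_recurrence (\<lambda>n k. A (n + d) (n + k)) d d z (\<lambda>n. f k n z)"
    and deriv: "\<And>k n z. k \<le> d \<Longrightarrow> 1 \<le> n \<Longrightarrow>
      (f k n has_field_derivative (\<Sum>l\<le>n + e. - B l n * f k l z)) (at z)"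
    and ker: "\<And>z M c. \<forall>i\<le>d. (\<Sum>k\<le>d. c k * f k (M + i) z) = 0 \<Longrightarrow> \<forall>k\<le>d. c k = 0"
    \<comment> \<open>The differential system is solved on the window at 1, which corresponds to N =
      d + 1.\<close>
    using two_sided_recurrence.compatible_system_solutions[OF row_recurrence row_compatible, of 1] by blast
  have det: "Determinant.det (window_mat d f n z) \<noteq> 0" for n z
    by (rule window_mat_det) (rule ker)
  define \<Psi> where "\<Psi> N = window_mat d f (nat (N - int d))" for N
  have "everywhere_invertible (d + 1) (\<Psi> N) \<and>
     (\<forall>x. \<Psi> (N + 1) x = ladder d c N x * \<Psi> N x) \<and>
     (\<forall>x. mat_has_derivative (\<Psi> N) (- diff_matrix d c e b N x * \<Psi> N x) x)"
    if N: "int d + 1 \<le> N" for N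
  proof -
    define n where "n = nat (N - int d)"
    have n: "N = int (n + d)" "1 \<le> n" using N by (auto simp: n_def)
    have \<Psi>: "\<Psi> N = window_mat d f n" "\<Psi> (N + 1) = window_mat d f (Suc n)"
      by (auto simp: \<Psi>_def n nat_add_distrib)
    have "mat_has_derivative (\<Psi> N) (- diff_matrix d c e b N x * \<Psi> N x) x" for x
      unfolding mat_has_derivative_def
    proof (intro allI impI)
      let ?D = "diff_matrix d c e b N x"
      have D: "?D \<in> carrier_mat (Suc d) (Suc d)"
        unfolding n by (rule diff_matrix_window(1)[where f = f, OF f det n(2)]) auto
      have eq: "- ?D * \<Psi> N x = - (?D * \<Psi> N x)"
        using D by (intro uminus_mult_left_mat) (simp add: \<Psi> window_mat_def)
      fix i k assume "i < dim_row (- ?D * \<Psi> N x)" "k < dim_col (- ?D * \<Psi> N x)"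
      hence ik: "i \<le> d" "k \<le> d" using D by (simp_all add: \<Psi> window_mat_def)
      have "(- ?D * \<Psi> N x) $$ (i, k) = - (?D * \<Psi> N x) $$ (i, k)"
        unfolding eq using D ik by (simp add: \<Psi> window_mat_def)
      also have "(?D * \<Psi> N x) $$ (i, k) = (\<Sum>l\<le>n + i + e. B l (n + i) * f k l x)"
        unfolding \<Psi> unfolding n(1) by (rule diff_matrix_window(2)[where f = f, OF f det n(2) ik])
      finally have "(- ?D * \<Psi> N x) $$ (i, k) = (\<Sum>l\<le>n + i + e. - B l (n + i) * f k l x)"
        by (simp add: sum_negf)
      moreover have "(\<lambda>w. \<Psi> N w $$ (i, k)) = f k (n + i)"
        using ik by (simp add: \<Psi> window_mat_entry)
      ultimately show "((\<lambda>w. \<Psi> N w $$ (i, k)) has_field_derivative (- ?D * \<Psi> N x) $$ (i, k)) (at x)"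
        using deriv[of k "n + i" x] ik n(2) by simp
    qed
    moreover have "\<Psi> (N + 1) x = ladder d c N x * \<Psi> N x" for x
      unfolding \<Psi> unfolding n(1) by (rule ladder_window[where f = f, OF f, symmetric])
    moreover have "everywhere_invertible (d + 1) (\<Psi> N)"
      using invertible_window_mat(1)[OF det] by (simp add: everywhere_invertible_def \<Psi>)
    ultimately show ?thesis by blast
  qed
  thus ?thesis by blast
qed

lemma ladder_bar_system:
  "\<exists>\<Phi> :: int \<Rightarrow> complex \<Rightarrow> complex mat. \<forall>N \<ge> int d + 1.
     everywhere_invertible (d + 1) (\<Phi> (N - 1)) \<and>
     (\<forall>x. \<Phi> (N - 1) x = \<Phi> N x * ladder_bar d c N x) \<and>
     (N \<ge> int e + 1 \<longrightarrow>
       (\<forall>x. mat_has_derivative (\<Phi> (N - 1)) (\<Phi> (N - 1) x * diff_matrix_bar d c e b N x) x))"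
proof -
  obtain g where g: "\<And>k z. solves_recurrence (\<lambda>n k. A (n + k) (Suc n)) d 1 z (\<lambda>n. g k n z)"
    and deriv: "\<And>k n z. k \<le> d \<Longrightarrow> e \<le> n \<Longrightarrow>
      (g k n has_field_derivative (\<Sum>l\<le>n + 1. B n l * g k l z)) (at z)"
    and ker: "\<And>z M c. \<forall>i\<le>d. (\<Sum>k\<le>d. c k * g k (M + i) z) = 0 \<Longrightarrow> \<forall>k\<le>d. c k = 0"
    \<comment> \<open>The window at e corresponds to N = e + 1, where the differential equation
      begins; the shifts hold for the extended solution at smaller indices too.\<close>
    using two_sided_recurrence.compatible_system_solutions[OF column_recurrence column_compatible, of e] by blast
  have det: "Determinant.det (window_mat d g n z) \<noteq> 0" for n z
    by (rule window_mat_det) (rule ker)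
  define \<Phi> where "\<Phi> N z = transpose_mat (window_mat d g (nat N) z)" for N z
  have "everywhere_invertible (d + 1) (\<Phi> (N - 1)) \<and>
     (\<forall>x. \<Phi> (N - 1) x = \<Phi> N x * ladder_bar d c N x) \<and>
     (N \<ge> int e + 1 \<longrightarrow>
       (\<forall>x. mat_has_derivative (\<Phi> (N - 1)) (\<Phi> (N - 1) x * diff_matrix_bar d c e b N x) x))"
    if N: "int d + 1 \<le> N" for N
  proof -
    define n where "n = nat (N - 1)"
    have n: "N = int n + 1" using N by (simp add: n_def)
    have \<Phi>: "\<Phi> (N - 1) z = transpose_mat (window_mat d g n z)"
      "\<Phi> N z = transpose_mat (window_mat d g (Suc n) z)" for z
      by (simp_all add: \<Phi>_def n nat_add_distrib)
    have "mat_has_derivative (\<Phi> (N - 1)) (\<Phi> (N - 1) x * diff_matrix_bar d c e b N x) x"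
      if e: "int e + 1 \<le> N" for x
      unfolding mat_has_derivative_def
    proof (intro allI impI)
      have en: "e \<le> n" using e n by simp
      let ?D = "diff_matrix_bar d c e b N x"
      have D: "?D \<in> carrier_mat (Suc d) (Suc d)"
        unfolding n by (rule window_diff_matrix_bar(1)[where g = g, OF g det en]) auto
      fix k i assume "k < dim_row (\<Phi> (N - 1) x * ?D)" "i < dim_col (\<Phi> (N - 1) x * ?D)"
      hence ik: "i \<le> d" "k \<le> d" using D by (simp_all add: \<Phi> window_mat_def)
      have "(\<Phi> (N - 1) x * ?D) $$ (k, i) = (\<Sum>l\<le>n + i + 1. B (n + i) l * g k l x)"
        unfolding \<Phi> unfolding n by (rule window_diff_matrix_bar(2)[where g = g, OF g det en ik])
      moreover have "(\<lambda>w. \<Phi> (N - 1) w $$ (k, i)) = g k (n + i)"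
        using ik by (simp add: \<Phi> window_mat_def)
      ultimately show "((\<lambda>w. \<Phi> (N - 1) w $$ (k, i)) has_field_derivative
          (\<Phi> (N - 1) x * ?D) $$ (k, i)) (at x)"
        using deriv[of k "n + i" x] ik en by simp
    qed
    moreover have "\<Phi> (N - 1) x = \<Phi> N x * ladder_bar d c N x" for x
      unfolding \<Phi> unfolding n by (rule window_ladder_bar[where g = g, OF g, symmetric])
    moreover have "everywhere_invertible (d + 1) (\<Phi> (N - 1))"
      using invertible_window_mat(2)[OF det] by (simp add: everywhere_invertible_def \<Phi>)
    ultimately show ?thesis by blast
  qed
  thus ?thesis by blast
qed

end

theorem proposition3p1:
  fixes d1 d2 :: nat
    and u v :: "nat \<Rightarrow> complex"
    and V1 V2 :: "complex \<Rightarrow> complex"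
    and Gx Gy :: "real \<Rightarrow> complex"
    and \<pi> \<sigma> :: "nat \<Rightarrow> complex poly"
    and h r :: "nat \<Rightarrow> complex"
    and \<psi> \<phi> :: "nat \<Rightarrow> complex \<Rightarrow> complex"
    and \<alpha> \<beta> :: "int \<Rightarrow> int \<Rightarrow> complex"
  assumes "d1 \<ge> 1" and "d2 \<ge> 1"
    and "u (d1 + 1) \<noteq> 0" and "v (d2 + 1) \<noteq> 0"
    and "V1 = potential d1 u" and "V2 = potential d2 v"
    and "admissible_contours V1 V2 Gx Gy"
    and "biorthogonal_polys V1 V2 Gx Gy \<pi> \<sigma> h"
    and "\<And>n. (r n)\<^sup>2 = h n"
    and "\<psi> = quasi_poly V1 \<pi> r" and "\<phi> = quasi_poly V2 \<sigma> r"
    and "recursion_coefficients d1 d2 r \<psi> \<phi> \<alpha> \<beta>"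
  shows
    "(\<exists>\<Psi> :: int \<Rightarrow> complex \<Rightarrow> complex mat.
        \<forall>N \<ge> int d2 + 1.
          everywhere_invertible (d2 + 1) (\<Psi> N) \<and>
          (\<forall>x. \<Psi> (N + 1) x = ladder d2 \<alpha> N x * \<Psi> N x) \<and>
          (\<forall>x. mat_has_derivative (\<Psi> N) (- diff_matrix d2 \<alpha> d1 \<beta> N x * \<Psi> N x) x))
     \<and>
     (\<exists>\<Phi> :: int \<Rightarrow> complex \<Rightarrow> complex mat.
        \<forall>N \<ge> int d1 + 1.
          everywhere_invertible (d1 + 1) (\<Phi> N) \<and>
          (\<forall>y. \<Phi> (N + 1) y = ladder d1 \<beta> N y * \<Phi> N y) \<and>
          (\<forall>y. mat_has_derivative (\<Phi> N) (- diff_matrix d1 \<beta> d2 \<alpha> N y * \<Phi> N y) y))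
     \<and>
     (\<exists>\<Psi>' :: int \<Rightarrow> complex \<Rightarrow> complex mat.
        \<forall>N \<ge> int d1 + 1.
          everywhere_invertible (d1 + 1) (\<Psi>' (N - 1)) \<and>
          (\<forall>y. \<Psi>' (N - 1) y = \<Psi>' N y * ladder_bar d1 \<beta> N y) \<and>
          (N \<ge> int d2 + 1 \<longrightarrow>
            (\<forall>y. mat_has_derivative (\<Psi>' (N - 1)) (\<Psi>' (N - 1) y * diff_matrix_bar d1 \<beta> d2 \<alpha> N y) y)))
     \<and>
     (\<exists>\<Phi>' :: int \<Rightarrow> complex \<Rightarrow> complex mat.
        \<forall>N \<ge> int d2 + 1.
          everywhere_invertible (d2 + 1) (\<Phi>' (N - 1)) \<and>
          (\<forall>x. \<Phi>' (N - 1) x = \<Phi>' N x * ladder_bar d2 \<alpha> N x) \<and>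
          (N \<ge> int d1 + 1 \<longrightarrow>
            (\<forall>x. mat_has_derivative (\<Phi>' (N - 1)) (\<Phi>' (N - 1) x * diff_matrix_bar d2 \<alpha> d1 \<beta> N x) x)))"
proof -
  note V1 = \<open>V1 = potential d1 u\<close> and V2 = \<open>V2 = potential d2 v\<close>
  have bi: "degree (\<pi> n) = n" "lead_coeff (\<pi> n) = 1" "degree (\<sigma> n) = n" "lead_coeff (\<sigma> n) = 1" "h n \<noteq> 0" for n
    using \<open>biorthogonal_polys V1 V2 Gx Gy \<pi> \<sigma> h\<close> unfolding biorthogonal_polys_def by blast+
  have r: "r n \<noteq> 0" for n
    using bi(5)[of n] \<open>\<And>n. (r n)\<^sup>2 = h n\<close>[of n] by auto
  note \<psi> = \<open>\<psi> = quasi_poly V1 \<pi> r\<close>[unfolded V1] and \<phi> = \<open>\<phi> = quasi_poly V2 \<sigma> r\<close>[unfolded V2]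
  note rec = \<open>recursion_coefficients d1 d2 r \<psi> \<phi> \<alpha> \<beta>\<close>[unfolded recursion_coefficients_def]
  have gamma: "\<alpha> (- 1) (int n) \<noteq> 0" "\<beta> (- 1) (int n) \<noteq> 0" for n
    using rec r by auto
  interpret x: quasi_poly_recursion d2 d1 \<alpha> \<beta> u \<pi> r "quasi_poly (potential d1 u) \<pi> r"
  proof unfold_locales
    show "x * quasi_poly (potential d1 u) \<pi> r n x =
       (\<Sum>j\<in>{j\<in>{- 1..int d2}. 0 \<le> int n - j}. \<alpha> j (int n) * quasi_poly (potential d1 u) \<pi> r (nat (int n - j)) x)" for n x
      using rec unfolding \<psi> by blast
    show "deriv (quasi_poly (potential d1 u) \<pi> r n) x =
       - (\<Sum>j\<in>{j\<in>{- 1..int d1}. 0 \<le> int n + j}. \<beta> j (int n + j) * quasi_poly (potential d1 u) \<pi> r (nat (int n + j)) x)" for n x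
      using rec unfolding \<psi> by blast
  qed (use bi r assms in auto)
  interpret y: quasi_poly_recursion d1 d2 \<beta> \<alpha> v \<sigma> r "quasi_poly (potential d2 v) \<sigma> r"
  proof unfold_locales
    show "x * quasi_poly (potential d2 v) \<sigma> r n x =
       (\<Sum>j\<in>{j\<in>{- 1..int d1}. 0 \<le> int n - j}. \<beta> j (int n) * quasi_poly (potential d2 v) \<sigma> r (nat (int n - j)) x)" for n x
      using rec unfolding \<phi> by blast
    show "deriv (quasi_poly (potential d2 v) \<sigma> r n) x =
       - (\<Sum>j\<in>{j\<in>{- 1..int d2}. 0 \<le> int n + j}. \<alpha> j (int n + j) * quasi_poly (potential d2 v) \<sigma> r (nat (int n + j)) x)" for n x
      using rec unfolding \<phi> by blast
  qed (use bi r assms in auto)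
  \<comment> \<open>The roles cross: \<alpha> multiplies in the \<psi> family but differentiates in
    the \<phi> family, so its top coefficient is nonzero because of \<open>v\<close>. The \<phi>
    family also supplies the transposed string equation.\<close>
  interpret xy: string_pair d2 d1 \<alpha> \<beta>
    by unfold_locales
      (fact \<open>1 \<le> d2\<close> gamma y.top_coeff_nonzero x.string_equation y.string_equation)+
  interpret yx: string_pair d1 d2 \<beta> \<alpha>
    by unfold_locales
      (fact \<open>1 \<le> d1\<close> gamma x.top_coeff_nonzero y.string_equation x.string_equation)+
  show ?thesis
    by (intro conjI xy.ladder_system yx.ladder_system yx.ladder_bar_system xy.ladder_bar_system)
qed

end
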